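(* Let $n\ge 3$ be an integer, $\theta\in(0,\pi]$, $f_0>0$, $B\in\mathbb{R}$, $T\subset[-1,1)$, $g:T\to\mathbb{R}$, and let $F\in\mathcal{F}(n,f_0,T,g,B,\theta)$. Let $G$ be a simple graph with $N$ vertices. Then every $(N,n,\theta)$ spherical code $C$ with $\mathrm{DG}(C,T)=G$ satisfies $$N^2\le\frac{F(1,1,1)+3(N-1)\,B+6\,\tau(G,n,\theta,T,g)}{f_0}.$$
   Context: Spherical codes. An $(N,n,\theta)$ spherical code is an $N$-element subset $C$ ($N\ge1$) of the unit sphere $\mathbb{S}^{n-1}\subset\mathbb{R}^n$ such that $c\cdot c'\le\cos\theta$ for all distinct $c,c'\in C$. Matrices $S_k^n$. Let $P_k^{n-1}$ denote the Gegenbauer polynomial of degree $k$ for dimension $n-1$, i.e. the polynomials orthogonal on $[-1,1]$ with respect to the weight $(1-t^2)^{(n-4)/2}$, normalized by $P_k^{n-1}(1)=1$. Fix $d\ge0$. For $0\le k\le d$ let $Y_k^n(x,y,z)$ be the $(d-k+1)\times(d-k+1)$ matrix with entries, indexed by $0\le i,j\le d-k$, $$\bigl(Y_k^n\bigr)_{ij}(x,y,z)=x^iy^j\bigl((1-x^2)(1-y^2)\bigr)^{k/2}P_k^{n-1}\!\left(\frac{z-xy}{\sqrt{(1-x^2)(1-y^2)}}\right),$$ (which is a polynomial in $x,y,z$), and let $S_k^n(x,y,z)=\frac16\sum_{\sigma}Y_k^n(\sigma(x,y,z))$, the sum being over all $6$ permutations $\sigma$ of the variables $(x,y,z)$. Write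 $\langle A,B\rangle=\operatorname{tr}(A^{T}B)$. Class $\mathrm{BV}(n,f_0)$. For $f_0>0$, $\mathrm{BV}(n,f_0)$ is the class of symmetric real polynomials $F(x,y,z)$ that can be written (for some $d$) as $F(x,y,z)=\sum_{k=0}^d\langle M_k,S_k^n(x,y,z)\rangle$ with all $M_k$ real symmetric positive semidefinite and $M_0-f_0E_0$ positive semidefinite, where $E_0$ is the matrix whose only nonzero entry is a $1$ in the top left corner (index $(0,0)$). Class $\mathcal{F}$. For $g:T\to\mathbb{R}$ with $T\subset[-1,1)$, put $g_T(x)=g(x)$ if $x\in T$ and $g_T(x)=0$ otherwise. Let $$D(\theta)=\{(x,y,z): -1\le x,y,z\le\cos\theta,\ 1+2xyz-x^2-y^2-z^2\ge0\}.$$ $\mathcal{F}(n,f_0,T,g,B,\theta)$ is the class of symmetric polynomials $F(x,y,z)$ such that: (1) $F\in\mathrm{BV}(n,f_0)$; (2) $F(x,x,1)\le B+2g_T(x)$ for all $x\in[-1,\cos\theta]$; (3) $F(x,y,z)\le g_T(x)+g_T(y)+g_T(z)$ for all $(x,y,z)\in D(\theta)$. The quantities $h_m$. Fix $e\in\mathbb{S}^{n-1}$ (the choice is irrelevant by rotation invariance). $A(n,\theta,T)$ is the maximal size of a set $C\subset\mathbb{S}^{n-1}$ with $c\cdot c'\le\cos\theta$ for all distinct $c,c'\in C$ and $c\cdot e\in T$ for all $c\in C$. For $1\le m\le A(n,\theta,T)$, let $Q(m,n,\theta,T)$ be the set of all $(m,n,\theta)$ spherical codes $Y$ with $y\cdot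 e\in T$ for all $y\in Y$, and $h_m(n,\theta,T,g)=\sup_{Y\in Q(m,n,\theta,T)}\sum_{y\in Y}g(e\cdot y)$ (possibly $+\infty$). Set $h_0=0$. Distance graphs and $\tau$. For finite $C\subset\mathbb{S}^{n-1}$, $\mathrm{DG}(C,T)$ is the graph with vertex set $C$ whose edges are the unordered pairs $\{c,c'\}$ with $c\cdot c'\in T$; $E(C,T)$ is its edge set, and $H_g(C,T)=\sum_{\{c,c'\}\in E(C,T)}g(c\cdot c')$ (each unordered edge counted once). Equality $\mathrm{DG}(C,T)=G$ is understood as graph isomorphism. For a simple graph $G$ with $N$ vertices, $Q(G,n,\theta,T)$ is the set of all $(N,n,\theta)$ spherical codes $C$ with $\mathrm{DG}(C,T)=G$, and $$\tau(G,n,\theta,T,g)=\sup H_g(C,T),$$ the supremum being over all $C\in Q(G,n,\theta,T)$ such that for every $c\in C$, $\sum_{c'\in C}g_T(c\cdot c')\le h_m(n,\theta,T,g)$, where $m$ is the degree of $c$ in $\mathrm{DG}(C,T)$. If $\tau=+\infty$ the inequality is regarded as trivially true. *)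

theory Defs
  imports
    "HOL-Analysis.Analysis"
    "HOL-Computational_Algebra.Polynomial"
    "Jordan_Normal_Form.Matrix"
begin

section \<open>Gegenbauer polynomials\<close>

text \<open>The weight for dimension \<open>m\<close>; with \<open>m = n - 1\<close> the exponent is \<open>(n - 4) / 2\<close>.\<close>

definition gegenbauer_weight :: "nat \<Rightarrow> real \<Rightarrow> real" where
  "gegenbauer_weight m t = (1 - t\<^sup>2) powr ((real m - 3) / 2)"

definition gegenbauer_family :: "nat \<Rightarrow> (nat \<Rightarrow> real poly) \<Rightarrow> bool" where
  "gegenbauer_family m P \<longleftrightarrow>
     (\<forall>k. degree (P k) = k \<and> poly (P k) 1 = 1) \<and>
     (\<forall>j k. j \<noteq> k \<longrightarrow>
        integral {-1..1} (\<lambda>t. poly (P j) t * poly (P k) t * gegenbauer_weight m t) = 0)"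

text \<open>For \<open>m \<ge> 2\<close> the family exists and is unique, see \<open>gegenbauer_family_ex1\<close> below.\<close>

definition gegenbauer :: "nat \<Rightarrow> nat \<Rightarrow> real poly" where
  "gegenbauer m = (THE P. gegenbauer_family m P)"


subsection \<open>Existence, uniqueness and parity\<close>

lemma gegenbauer_weight_nonneg: "0 \<le> gegenbauer_weight m t"
  by (simp add: gegenbauer_weight_def)

lemma gegenbauer_weight_2_integrable: "gegenbauer_weight 2 absolutely_integrable_on {-1..1}"
proof (rule nonnegative_absolutely_integrable_1)
  have "(gegenbauer_weight 2 has_integral (arcsin 1 - arcsin (-1))) {-1..1}"
  proof (rule fundamental_theorem_of_calculus_interior)
    show "continuous_on {- 1..1} arcsin" by (rule continuous_on_arcsin')
    fix x :: real assume x: "x \<in> {-1<..<1}"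
    then have "x\<^sup>2 < 1" by (auto simp: abs_square_less_1)
    then have "gegenbauer_weight 2 x = inverse (sqrt (1 - x\<^sup>2))"
      by (simp add: gegenbauer_weight_def powr_minus powr_half_sqrt)
    with DERIV_arcsin[of x] x
    show "(arcsin has_vector_derivative gegenbauer_weight 2 x) (at x)"
      by (simp add: has_real_derivative_iff_has_vector_derivative)
  qed simp
  then show "gegenbauer_weight 2 integrable_on {-1..1}" by blast
qed (simp add: gegenbauer_weight_nonneg)

lemma gegenbauer_weight_integrable:
  assumes "m \<ge> 2" and "continuous_on {-1..1} h"
  shows "(\<lambda>t. h t * gegenbauer_weight m t) integrable_on {-1..1}"
proof -
  let ?u = "\<lambda>t::real. h t * (if m = 2 then 1 else (1 - t\<^sup>2) powr ((real m - 2) / 2))"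
  have nn: "0 \<le> 1 - t\<^sup>2" if "t \<in> {-1..1}" for t :: real
    using that by (auto simp: abs_square_le_1)
  have cont: "continuous_on {-1..1} ?u"
    using assms nn
    by (cases "m = 2") (auto intro!: continuous_intros continuous_on_powr')
  have "(\<lambda>t. ?u t * gegenbauer_weight 2 t) absolutely_integrable_on {-1..1}"
  proof (rule absolutely_integrable_bounded_measurable_product_real)
    show "?u \<in> borel_measurable (lebesgue_on {-1..1})"
      using cont by (rule continuous_imp_measurable_on_sets_lebesgue) simp
    show "bounded (?u ` {-1..1})"
      using cont by (intro compact_imp_bounded compact_continuous_image) auto
  qed (use gegenbauer_weight_2_integrable in auto)
  then have "(\<lambda>t. ?u t * gegenbauer_weight 2 t) integrable_on {-1..1}"
    using set_lebesgue_integral_eq_integral(1) by blast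
  moreover have "?u t * gegenbauer_weight 2 t = h t * gegenbauer_weight m t" for t
  proof (cases "m = 2")
    case False
    have "(real m - 2) / 2 + (real 2 - 3) / 2 = (real m - 3) / 2" by (simp add: field_simps)
    then have "(1 - t\<^sup>2) powr ((real m - 2) / 2) * (1 - t\<^sup>2) powr ((real 2 - 3) / 2) =
        (1 - t\<^sup>2) powr ((real m - 3) / 2)"
      by (metis powr_add)
    then show ?thesis using False by (simp add: gegenbauer_weight_def mult.assoc)
  qed simp
  ultimately show ?thesis by simp
qed

definition gegenbauer_int :: "nat \<Rightarrow> real poly \<Rightarrow> real" where
  "gegenbauer_int m p = integral {-1..1} (\<lambda>t. poly p t * gegenbauer_weight m t)"

lemma gegenbauer_int_integrable:
  "m \<ge> 2 \<Longrightarrow> (\<lambda>t. poly p t * gegenbauer_weight m t) integrable_on {-1..1}"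
  by (rule gegenbauer_weight_integrable) (auto intro!: continuous_intros)

lemma gegenbauer_int_add:
  "m \<ge> 2 \<Longrightarrow> gegenbauer_int m (p + q) = gegenbauer_int m p + gegenbauer_int m q"
  unfolding gegenbauer_int_def
  by (simp add: ring_distribs integral_add gegenbauer_int_integrable)

lemma gegenbauer_int_smult: "gegenbauer_int m (Polynomial.smult c p) = c * gegenbauer_int m p"
  unfolding gegenbauer_int_def by (simp add: mult.assoc)

lemma gegenbauer_int_diff:
  "m \<ge> 2 \<Longrightarrow> gegenbauer_int m (p - q) = gegenbauer_int m p - gegenbauer_int m q"
  using gegenbauer_int_add[of m p "Polynomial.smult (-1) q"] gegenbauer_int_smult[of m "-1" q] by simp

lemma gegenbauer_int_0 [simp]: "gegenbauer_int m 0 = 0"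
  by (simp add: gegenbauer_int_def)

lemma gegenbauer_int_reflect:
  "gegenbauer_int m (pcompose p [:0, -1:]) = gegenbauer_int m p"
proof -
  have "integral {-1..1} (\<lambda>t. poly p (-t) * gegenbauer_weight m (-t)) =
        integral {-1..1} (\<lambda>t. poly p t * gegenbauer_weight m t)"
    using Henstock_Kurzweil_Integration.integral_reflect_real
      [of 1 "-1" "\<lambda>t. poly p t * gegenbauer_weight m t"] by simp
  then show ?thesis
    by (simp add: gegenbauer_int_def poly_pcompose gegenbauer_weight_def)
qed

lemma gegenbauer_int_pos:
  assumes m: "m \<ge> 2" and p: "p \<noteq> 0" and nn: "\<And>t. t \<in> {-1..1} \<Longrightarrow> 0 \<le> poly p t"
  shows "0 < gegenbauer_int m p"
proof -
  let ?f = "\<lambda>t. poly p t * gegenbauer_weight m t"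
  have pos: "0 < 1 - t\<^sup>2" if "t \<in> {-1/2..1/2}" for t :: real
  proof -
    have "\<bar>t\<bar> < 1" using that by auto
    then show ?thesis by (simp add: abs_square_less_1)
  qed
  have cont: "continuous_on {-1/2..1/2} ?f"
    unfolding gegenbauer_weight_def by (intro continuous_intros) (use pos in force)+
  have nn': "0 \<le> ?f t" if "t \<in> {-1..1}" for t
    using nn[OF that] gegenbauer_weight_nonneg by simp
  have "integral {-1/2..1/2} ?f \<noteq> 0"
  proof
    assume "integral {-1/2..1/2} ?f = 0"
    then have "\<forall>t\<in>{-1/2..1/2}. ?f t = 0"
      using integral_eq_0_iff[OF cont] nn' by fastforce
    then have "\<forall>t\<in>{-1/2..1/2}. poly p t = 0"
      using pos by (fastforce simp: gegenbauer_weight_def)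
    then have "{-1/2..1/2} \<subseteq> {t. poly p t = 0}" by blast
    then have "finite {-1/2..1/2 :: real}"
      using poly_roots_finite[OF p] finite_subset by blast
    then show False using infinite_Icc[of "-1/2" "1/2 :: real"] by simp
  qed
  moreover have "0 \<le> integral {-1/2..1/2} ?f"
    using nn' cont by (intro integral_nonneg integrable_continuous_real) auto
  moreover have "integral {-1/2..1/2} ?f \<le> integral {-1..1} ?f"
    using nn' gegenbauer_int_integrable[OF m, of p] integrable_continuous_real[OF cont]
    by (intro integral_subset_le) auto
  ultimately show ?thesis by (simp add: gegenbauer_int_def)
qed

text \<open>Polynomials of degree less than \<open>k\<close>, with only \<open>0\<close> for \<open>k = 0\<close>.\<close>

definition low_polys :: "nat \<Rightarrow> real poly set" where
  "low_polys k = {p. \<forall>i\<ge>k. coeff p i = 0}"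

lemma low_polys_0: "q \<in> low_polys 0 \<longleftrightarrow> q = 0"
  by (auto simp: low_polys_def poly_eq_iff)

definition monic_orth :: "nat \<Rightarrow> nat \<Rightarrow> real poly \<Rightarrow> bool" where
  "monic_orth m k p \<longleftrightarrow> degree p = k \<and> coeff p k = 1 \<and>
     (\<forall>q\<in>low_polys k. gegenbauer_int m (p * q) = 0)"

lemma monic_orth_of_projection:
  assumes m: "m \<ge> 2"
    and proj: "\<exists>r\<in>low_polys k. \<forall>q\<in>low_polys k. gegenbauer_int m ((monom 1 k - r) * q) = 0"
  shows "\<exists>p. monic_orth m k p"
proof -
  obtain r where r: "r \<in> low_polys k"
    and orth: "\<And>q. q \<in> low_polys k \<Longrightarrow> gegenbauer_int m ((monom 1 k - r) * q) = 0"
    using proj by blast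
  have c: "coeff (monom 1 k - r) k = 1" "\<And>i. i > k \<Longrightarrow> coeff (monom 1 k - r) i = 0"
    using r by (auto simp: low_polys_def)
  have "degree (monom 1 k - r) = k"
    by (intro antisym degree_le le_degree) (use c in auto)
  then show ?thesis using c orth unfolding monic_orth_def by blast
qed

lemma gegenbauer_projection:
  assumes m: "m \<ge> 2"
  shows "\<exists>r\<in>low_polys k. \<forall>q\<in>low_polys k. gegenbauer_int m ((f - r) * q) = 0"
proof (induction k arbitrary: f)
  case 0
  show ?case by (intro bexI[of _ 0]) (auto simp: low_polys_0)
next
  case (Suc k)
  obtain p where p: "degree p = k" "coeff p k = 1"
    "\<And>q. q \<in> low_polys k \<Longrightarrow> gegenbauer_int m (p * q) = 0"
    using monic_orth_of_projection[OF m Suc.IH] unfolding monic_orth_def by blast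
  obtain r where r: "r \<in> low_polys k"
    "\<And>q. q \<in> low_polys k \<Longrightarrow> gegenbauer_int m ((f - r) * q) = 0"
    using Suc.IH by blast
  have pp: "gegenbauer_int m (p * p) > 0"
    using p by (intro gegenbauer_int_pos[OF m]) auto
  define a where "a = gegenbauer_int m (f * p) / gegenbauer_int m (p * p)"
  have pr: "gegenbauer_int m (r * p) = 0" using p(3)[OF r(1)] by (simp add: mult.commute)
  have "r + Polynomial.smult a p \<in> low_polys (Suc k)"
    using r(1) p(1) by (auto simp: low_polys_def coeff_eq_0)
  moreover have "gegenbauer_int m ((f - (r + Polynomial.smult a p)) * q) = 0" if q: "q \<in> low_polys (Suc k)" for q
  proof -
    define q' where "q' = q - Polynomial.smult (coeff q k) p"
    have "coeff q' i = 0" if "i \<ge> k" for i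
      using q p(1,2) that by (cases "i = k") (auto simp: q'_def low_polys_def coeff_eq_0)
    then have q': "q' \<in> low_polys k" by (auto simp: low_polys_def)
    have "q = q' + Polynomial.smult (coeff q k) p" by (simp add: q'_def)
    then have "(f - (r + Polynomial.smult a p)) * q = ((f - r) * q' - Polynomial.smult a (p * q')) +
        Polynomial.smult (coeff q k) ((f * p - r * p) - Polynomial.smult a (p * p))"
      by (metis (no_types, opaque_lifting) diff_diff_eq left_diff_distrib mult_smult_left
          mult_smult_right ring_distribs(1) smult_diff_right)
    then show ?thesis
      using r(2)[OF q'] p(3)[OF q'] pr pp
      by (simp add: gegenbauer_int_add[OF m] gegenbauer_int_diff[OF m] gegenbauer_int_smult a_def)
  qed
  ultimately show ?case by blast
qed

lemma monic_orth_exists: "m \<ge> 2 \<Longrightarrow> \<exists>p. monic_orth m k p"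
  using monic_orth_of_projection gegenbauer_projection by blast

lemma orth_unique:
  assumes m: "m \<ge> 2" and p: "monic_orth m k p" and d: "\<And>i. i > k \<Longrightarrow> coeff p' i = 0"
    and orth: "\<And>q. q \<in> low_polys k \<Longrightarrow> gegenbauer_int m (p' * q) = 0"
  shows "p' = Polynomial.smult (coeff p' k) p"
proof -
  define r where "r = p' - Polynomial.smult (coeff p' k) p"
  have pd: "degree p = k" "coeff p k = 1"
    and po: "\<And>q. q \<in> low_polys k \<Longrightarrow> gegenbauer_int m (p * q) = 0"
    using p by (auto simp: monic_orth_def)
  have "coeff r i = 0" if "i \<ge> k" for i
    using d pd that by (cases "i = k") (auto simp: r_def coeff_eq_0)
  then have r: "r \<in> low_polys k" by (simp add: low_polys_def)
  have "r * r = p' * r - Polynomial.smult (coeff p' k) (p * r)"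
    unfolding r_def by (simp add: left_diff_distrib)
  then have "gegenbauer_int m (r * r) = 0"
    using orth[OF r] po[OF r] by (simp add: gegenbauer_int_diff[OF m] gegenbauer_int_smult)
  then have "r = 0" using gegenbauer_int_pos[OF m, of "r * r"] by auto
  then show ?thesis by (simp add: r_def)
qed

lemma coeff_pcompose_neg: "coeff (pcompose p [:0, -1:]) i = (-1) ^ i * coeff (p :: real poly) i"
  using coeff_pcompose_linear[of p "-1" i] by simp

lemma monic_orth_parity:
  assumes m: "m \<ge> 2" and p: "monic_orth m k p"
  shows "pcompose p [:0, -1:] = Polynomial.smult ((-1) ^ k) p"
proof -
  have pd: "degree p = k" "coeff p k = 1"
    and po: "\<And>q. q \<in> low_polys k \<Longrightarrow> gegenbauer_int m (p * q) = 0"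
    using p by (auto simp: monic_orth_def)
  have "gegenbauer_int m (pcompose p [:0, -1:] * q) = 0" if q: "q \<in> low_polys k" for q
  proof -
    have "pcompose q [:0, -1:] \<in> low_polys k"
      using q by (auto simp: low_polys_def coeff_pcompose_neg)
    then have "gegenbauer_int m (p * pcompose q [:0, -1:]) = 0" by (rule po)
    moreover have "pcompose (pcompose q [:0, -1:]) [:0, -1:] = q"
      by (simp add: poly_eq_iff coeff_pcompose_neg power_mult_distrib[symmetric] mult.assoc[symmetric])
    ultimately show ?thesis
      using gegenbauer_int_reflect[of m "p * pcompose q [:0, -1:]"] by (simp add: pcompose_mult)
  qed
  from orth_unique[OF m p _ this] show ?thesis
    using pd by (simp add: coeff_pcompose_neg coeff_eq_0)
qed

lemma monic_orth_at_1:
  assumes m: "m \<ge> 2" and p: "monic_orth m k p"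
  shows "poly p 1 \<noteq> 0"
proof
  assume 1: "poly p 1 = 0"
  have "poly (pcompose p [:0, -1:]) 1 = 0"
    unfolding monic_orth_parity[OF m p] using 1 by simp
  then have neg1: "poly p (-1) = 0" by (simp add: poly_pcompose)
  obtain q1 where q1: "p = [:-1, 1:] * q1" using 1 by (auto simp: poly_eq_0_iff_dvd elim: dvdE)
  with neg1 have "poly q1 (-1) = 0" by simp
  then obtain q where "q1 = [:1, 1:] * q" using poly_eq_0_iff_dvd[of q1 "-1"] by (auto elim: dvdE)
  with q1 have pq: "p = [:-1, 0, 1:] * q" by simp
  have pd: "degree p = k" and "p \<noteq> 0"
    and po: "\<And>q. q \<in> low_polys k \<Longrightarrow> gegenbauer_int m (p * q) = 0"
    using p by (auto simp: monic_orth_def)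
  then have q0: "q \<noteq> 0" using pq by auto
  have "degree p = 2 + degree q" unfolding pq using q0 by (subst degree_mult_eq) auto
  then have "q \<in> low_polys k" using pd by (auto simp: low_polys_def coeff_eq_0)
  then have "gegenbauer_int m (p * q) = 0" by (rule po)
  moreover have "0 < gegenbauer_int m (Polynomial.smult (-1) (p * q))"
  proof (rule gegenbauer_int_pos[OF m])
    show "Polynomial.smult (- 1) (p * q) \<noteq> 0" using q0 \<open>p \<noteq> 0\<close> by simp
    fix t :: real assume "t \<in> {-1..1}"
    then have "t\<^sup>2 \<le> 1" by (auto simp: abs_square_le_1)
    then have "0 \<le> (1 - t\<^sup>2) * (poly q t)\<^sup>2" by simp
    then show "0 \<le> poly (Polynomial.smult (- 1) (p * q)) t"
      by (simp add: pq algebra_simps power2_eq_square)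
  qed
  ultimately show False using gegenbauer_int_smult[of m "-1" "p * q"] by simp
qed

lemma gegenbauer_family_orth_low:
  assumes m: "m \<ge> 2" and P: "gegenbauer_family m P" and q: "q \<in> low_polys k"
  shows "gegenbauer_int m (P k * q) = 0"
proof -
  have "\<forall>q\<in>low_polys i. gegenbauer_int m (P k * q) = 0" if "i \<le> k" for i
    using that
  proof (induction i)
    case 0
    show ?case by (auto simp: low_polys_0)
  next
    case (Suc i)
    show ?case
    proof
      fix q assume q: "q \<in> low_polys (Suc i)"
      have d: "degree (P i) = i" "poly (P i) 1 = 1" using P by (auto simp: gegenbauer_family_def)
      then have "P i \<noteq> 0" by auto
      then have c: "coeff (P i) i \<noteq> 0" using d(1) leading_coeff_neq_0 by metis
      define q' where "q' = q - Polynomial.smult (coeff q i / coeff (P i) i) (P i)"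
      have "coeff q' j = 0" if "j \<ge> i" for j
        using q c d that by (cases "j = i") (auto simp: q'_def low_polys_def coeff_eq_0)
      then have "q' \<in> low_polys i" by (simp add: low_polys_def)
      then have "gegenbauer_int m (P k * q') = 0" using Suc by simp
      moreover have "gegenbauer_int m (P k * P i) = 0"
        using P Suc.prems by (simp add: gegenbauer_family_def gegenbauer_int_def)
      moreover have "P k * q = P k * q' + Polynomial.smult (coeff q i / coeff (P i) i) (P k * P i)"
        by (simp add: q'_def ring_distribs)
      ultimately show "gegenbauer_int m (P k * q) = 0"
        by (simp add: gegenbauer_int_add[OF m] gegenbauer_int_smult)
    qed
  qed
  then show ?thesis using q by blast
qed

lemma gegenbauer_family_eq:
  assumes m: "m \<ge> 2" and P: "gegenbauer_family m P" and p: "monic_orth m k p"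
  shows "P k = Polynomial.smult (inverse (poly p 1)) p"
proof -
  have d: "degree (P k) = k" "poly (P k) 1 = 1" using P by (auto simp: gegenbauer_family_def)
  have *: "P k = Polynomial.smult (coeff (P k) k) p"
    using d gegenbauer_family_orth_low[OF m P] by (intro orth_unique[OF m p]) (auto simp: coeff_eq_0)
  then have "poly (P k) 1 = coeff (P k) k * poly p 1" by (metis poly_smult)
  then have "coeff (P k) k = inverse (poly p 1)"
    using d(2) monic_orth_at_1[OF m p] by (simp add: field_simps)
  with * show ?thesis by simp
qed

theorem gegenbauer_family_ex1:
  assumes m: "m \<ge> 2"
  shows "\<exists>!P. gegenbauer_family m P"
proof -
  obtain p where p: "\<And>k. monic_orth m k (p k)"
    using monic_orth_exists[OF m] by metis
  define P where "P k = Polynomial.smult (inverse (poly (p k) 1)) (p k)" for k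
  have n1: "poly (p k) 1 \<noteq> 0" for k by (rule monic_orth_at_1[OF m p])
  have pd: "degree (p k) = k" for k using p by (simp add: monic_orth_def)
  have less: "gegenbauer_int m (P k * P j) = 0" if "j < k" for j k
  proof -
    have "p j \<in> low_polys k" using pd that by (auto simp: low_polys_def coeff_eq_0)
    then have "gegenbauer_int m (p k * p j) = 0" using p by (auto simp: monic_orth_def)
    then show ?thesis by (simp add: P_def gegenbauer_int_smult)
  qed
  have "gegenbauer_int m (P j * P k) = 0" if "j \<noteq> k" for j k
    using less[of j k] less[of k j] that by (metis linorder_neqE_nat mult.commute)
  then have "\<forall>j k. j \<noteq> k \<longrightarrow>
      integral {-1..1} (\<lambda>t. poly (P j) t * poly (P k) t * gegenbauer_weight m t) = 0"
    by (simp add: gegenbauer_int_def)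
  moreover have "degree (P k) = k \<and> poly (P k) 1 = 1" for k
    using n1 pd by (simp add: P_def)
  ultimately have "gegenbauer_family m P" by (simp add: gegenbauer_family_def)
  moreover have "Q = P" if "gegenbauer_family m Q" for Q
    using gegenbauer_family_eq[OF m that p] by (auto simp: P_def)
  ultimately show ?thesis by blast
qed

lemma gegenbauer_family_gegenbauer: "m \<ge> 2 \<Longrightarrow> gegenbauer_family m (gegenbauer m)"
  unfolding gegenbauer_def by (rule theI'[OF gegenbauer_family_ex1])

lemma coeff_gegenbauer_odd:
  assumes m: "m \<ge> 2" and "odd (k + l)"
  shows "coeff (gegenbauer m k) l = 0"
proof -
  obtain p where p: "monic_orth m k p" using monic_orth_exists[OF m] by blast
  have "(-1) ^ l * coeff p l = (-1) ^ k * coeff p l"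
    using arg_cong[OF monic_orth_parity[OF m p], of "\<lambda>q. coeff q l"] by (simp add: coeff_pcompose_neg)
  then have "coeff p l = 0" using \<open>odd (k + l)\<close> by (cases "even k") auto
  then show ?thesis using gegenbauer_family_eq[OF m gegenbauer_family_gegenbauer[OF m] p] by simp
qed


section \<open>The matrices \<open>Y\<close> and \<open>S\<close>\<close>

text \<open>
  The polynomial \<open>((1 - x\<^sup>2) (1 - y\<^sup>2))\<^bsup>k/2\<^esup> P (u / sqrt ((1 - x\<^sup>2) (1 - y\<^sup>2)))\<close> with
  \<open>u = z - x y\<close> and \<open>P\<close> the Gegenbauer polynomial of degree \<open>k\<close> for dimension \<open>n - 1\<close>, written
  out termwise so that it makes sense for all real arguments, in particular \<open>x\<^sup>2 = 1\<close> or
  \<open>y\<^sup>2 = 1\<close>. Only terms with \<open>k - l\<close> even occur. See \<open>Y_mat_entry\<close> for the closed formula.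
\<close>

definition Y_factor :: "nat \<Rightarrow> nat \<Rightarrow> real \<Rightarrow> real \<Rightarrow> real \<Rightarrow> real" where
  "Y_factor n k x y z =
     (\<Sum>l\<le>k. coeff (gegenbauer (n - 1) k) l * (z - x * y) ^ l *
        ((1 - x\<^sup>2) * (1 - y\<^sup>2)) ^ ((k - l) div 2))"

definition Y_mat :: "nat \<Rightarrow> nat \<Rightarrow> nat \<Rightarrow> real \<Rightarrow> real \<Rightarrow> real \<Rightarrow> real mat" where
  "Y_mat n d k x y z =
     mat (d - k + 1) (d - k + 1) (\<lambda>(i, j). x ^ i * y ^ j * Y_factor n k x y z)"

lemma Y_mat_entry:
  assumes n: "n \<ge> 3" and pos: "(1 - x\<^sup>2) * (1 - y\<^sup>2) > 0" and ij: "i \<le> d - k" "j \<le> d - k"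
  shows "Y_mat n d k x y z $$ (i, j) =
     x ^ i * y ^ j * ((1 - x\<^sup>2) * (1 - y\<^sup>2)) powr (real k / 2) *
       poly (gegenbauer (n - 1) k) ((z - x * y) / sqrt ((1 - x\<^sup>2) * (1 - y\<^sup>2)))"
proof -
  define w where "w = (1 - x\<^sup>2) * (1 - y\<^sup>2)"
  define s where "s = sqrt w"
  have w: "w > 0" using pos by (simp add: w_def)
  then have s: "s > 0" "s\<^sup>2 = w" by (auto simp: s_def)
  have m: "n - 1 \<ge> 2" using n by simp
  have wk: "w powr (real k / 2) = s ^ k"
    using w by (simp add: s_def powr_half_sqrt[symmetric] powr_realpow[symmetric] powr_powr)
  have "degree (gegenbauer (n - 1) k) = k"
    using gegenbauer_family_gegenbauer[OF m] by (simp add: gegenbauer_family_def)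
  then have "s ^ k * poly (gegenbauer (n - 1) k) ((z - x * y) / s) =
      (\<Sum>l\<le>k. s ^ k * (coeff (gegenbauer (n - 1) k) l * ((z - x * y) / s) ^ l))"
    by (simp add: poly_altdef sum_distrib_left)
  also have "\<dots> = (\<Sum>l\<le>k. coeff (gegenbauer (n - 1) k) l * (z - x * y) ^ l * w ^ ((k - l) div 2))"
  proof (rule sum.cong[OF refl])
    fix l assume "l \<in> {..k}"
    then have l: "l \<le> k" by simp
    show "s ^ k * (coeff (gegenbauer (n - 1) k) l * ((z - x * y) / s) ^ l) =
        coeff (gegenbauer (n - 1) k) l * (z - x * y) ^ l * w ^ ((k - l) div 2)"
    proof (cases "odd (k + l)")
      case True
      then show ?thesis using coeff_gegenbauer_odd[OF m] by simp
    next
      case False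
      then have "even (k - l)" using l by presburger
      then have "w ^ ((k - l) div 2) = s ^ (k - l)"
        by (simp add: s(2)[symmetric] power_mult[symmetric])
      moreover have "s ^ k = s ^ (k - l) * s ^ l" using l by (simp add: power_add[symmetric])
      ultimately show ?thesis using s(1) by (simp add: power_divide)
    qed
  qed
  finally show ?thesis
    using ij wk by (simp add: Y_mat_def Y_factor_def w_def s_def mult.assoc)
qed

definition S_mat :: "nat \<Rightarrow> nat \<Rightarrow> nat \<Rightarrow> real \<Rightarrow> real \<Rightarrow> real \<Rightarrow> real mat" where
  "S_mat n d k x y z = (1 / 6) \<cdot>\<^sub>m
     (Y_mat n d k x y z + Y_mat n d k x z y + Y_mat n d k y x z +
      Y_mat n d k y z x + Y_mat n d k z x y + Y_mat n d k z y x)"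

definition mat_inner :: "real mat \<Rightarrow> real mat \<Rightarrow> real" where
  "mat_inner A B = (let M = transpose_mat A * B in \<Sum>i<dim_row M. M $$ (i, i))"

definition psd :: "nat \<Rightarrow> real mat \<Rightarrow> bool" where
  "psd r M \<longleftrightarrow> M \<in> carrier_mat r r \<and> transpose_mat M = M \<and>
     (\<forall>v\<in>carrier_vec r. 0 \<le> scalar_prod v (M *\<^sub>v v))"

definition E0_mat :: "nat \<Rightarrow> real mat" where
  "E0_mat r = mat r r (\<lambda>(i, j). if i = 0 \<and> j = 0 then 1 else 0)"


section \<open>The classes \<open>BV\<close> and \<open>\<F>\<close>\<close>

text \<open>Polynomials in three variables are represented by their polynomial functions.\<close>

definition symmetric_poly3 :: "(real \<Rightarrow> real \<Rightarrow> real \<Rightarrow> real) \<Rightarrow> bool" where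
  "symmetric_poly3 F \<longleftrightarrow>
     real_polynomial_function (\<lambda>(x, y, z). F x y z) \<and>
     (\<forall>x y z. F x y z = F y x z \<and> F x y z = F x z y)"

definition BV :: "nat \<Rightarrow> real \<Rightarrow> (real \<Rightarrow> real \<Rightarrow> real \<Rightarrow> real) set" where
  "BV n f0 = {F. symmetric_poly3 F \<and>
     (\<exists>d M. (\<forall>k\<le>d. psd (d - k + 1) (M k)) \<and>
        psd (d + 1) (M 0 - f0 \<cdot>\<^sub>m E0_mat (d + 1)) \<and>
        (\<forall>x y z. F x y z = (\<Sum>k\<le>d. mat_inner (M k) (S_mat n d k x y z))))}"

definition ext_zero :: "real set \<Rightarrow> (real \<Rightarrow> real) \<Rightarrow> real \<Rightarrow> real" where
  "ext_zero T g x = (if x \<in> T then g x else 0)"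

definition D_region :: "real \<Rightarrow> (real \<times> real \<times> real) set" where
  "D_region \<theta> = {(x, y, z).
     x \<in> {-1..cos \<theta>} \<and> y \<in> {-1..cos \<theta>} \<and> z \<in> {-1..cos \<theta>} \<and>
     1 + 2 * x * y * z - x\<^sup>2 - y\<^sup>2 - z\<^sup>2 \<ge> 0}"

definition class_F ::
  "nat \<Rightarrow> real \<Rightarrow> real set \<Rightarrow> (real \<Rightarrow> real) \<Rightarrow> real \<Rightarrow> real \<Rightarrow> (real \<Rightarrow> real \<Rightarrow> real \<Rightarrow> real) set" where
  "class_F n f0 T g B \<theta> = {F. symmetric_poly3 F \<and> F \<in> BV n f0 \<and>
     (\<forall>x\<in>{-1..cos \<theta>}. F x x 1 \<le> B + 2 * ext_zero T g x) \<and>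
     (\<forall>(x, y, z)\<in>D_region \<theta>. F x y z \<le> ext_zero T g x + ext_zero T g y + ext_zero T g z)}"


section \<open>Spherical codes and distance graphs\<close>

text \<open>The ambient dimension \<open>n\<close> is \<open>CARD('n)\<close>.\<close>

definition spherical_code :: "nat \<Rightarrow> real \<Rightarrow> (real ^ 'n) set \<Rightarrow> bool" where
  "spherical_code N \<theta> C \<longleftrightarrow> N \<ge> 1 \<and> finite C \<and> card C = N \<and> C \<subseteq> sphere 0 1 \<and>
     (\<forall>c\<in>C. \<forall>c'\<in>C. c \<noteq> c' \<longrightarrow> inner c c' \<le> cos \<theta>)"

text \<open>
  The set \<open>Q(m, n, \<theta>, T)\<close> and the numbers \<open>h\<^sub>m\<close>, relative to a fixed unit vector \<open>e\<close>. If \<open>m\<close>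
  exceeds the maximal size \<open>A(n, \<theta>, T)\<close>, then \<open>Q\<close> is empty and \<open>h_val e m\<close> is \<open>-\<infinity>\<close>; this value is
  irrelevant because degrees in the distance graph of a code do not exceed \<open>A(n, \<theta>, T)\<close>.
\<close>

definition Q_pole :: "real ^ 'n \<Rightarrow> nat \<Rightarrow> real \<Rightarrow> real set \<Rightarrow> (real ^ 'n) set set" where
  "Q_pole e m \<theta> T = {Y. spherical_code m \<theta> Y \<and> (\<forall>y\<in>Y. inner y e \<in> T)}"

definition h_val :: "real ^ 'n \<Rightarrow> nat \<Rightarrow> real \<Rightarrow> real set \<Rightarrow> (real \<Rightarrow> real) \<Rightarrow> ereal" where
  "h_val e m \<theta> T g = (if m = 0 then 0 else (SUP Y\<in>Q_pole e m \<theta> T. ereal (\<Sum>y\<in>Y. g (inner e y))))"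

text \<open>Graphs are pairs of a vertex set and a set of two-element vertex sets.\<close>

type_synonym 'v graph = "'v set \<times> 'v set set"

definition simple_graph :: "'v graph \<Rightarrow> bool" where
  "simple_graph G \<longleftrightarrow> finite (fst G) \<and> (\<forall>a\<in>snd G. a \<subseteq> fst G \<and> card a = 2)"

definition graph_iso :: "'v graph \<Rightarrow> 'w graph \<Rightarrow> bool" where
  "graph_iso G H \<longleftrightarrow> (\<exists>f. bij_betw f (fst G) (fst H) \<and> snd H = (\<lambda>a. f ` a) ` snd G)"

definition DG_edges :: "(real ^ 'n) set \<Rightarrow> real set \<Rightarrow> (real ^ 'n) set set" where
  "DG_edges C T = {{c, c'} | c c'. c \<in> C \<and> c' \<in> C \<and> c \<noteq> c' \<and> inner c c' \<in> T}"

definition DG :: "(real ^ 'n) set \<Rightarrow> real set \<Rightarrow> (real ^ 'n) graph" where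
  "DG C T = (C, DG_edges C T)"

definition graph_degree :: "'v graph \<Rightarrow> 'v \<Rightarrow> nat" where
  "graph_degree G v = card {a \<in> snd G. v \<in> a}"

text \<open>The inner product of the two endpoints of an unordered pair.\<close>

definition edge_inner :: "(real ^ 'n) set \<Rightarrow> real" where
  "edge_inner a = (THE t. \<exists>c c'. a = {c, c'} \<and> c \<noteq> c' \<and> t = inner c c')"

lemma edge_inner_pair: "c \<noteq> c' \<Longrightarrow> edge_inner {c, c'} = inner c c'"
  unfolding edge_inner_def by (rule the_equality) (auto simp: doubleton_eq_iff inner_commute)

definition H_sum :: "(real \<Rightarrow> real) \<Rightarrow> (real ^ 'n) set \<Rightarrow> real set \<Rightarrow> real" where
  "H_sum g C T = (\<Sum>a\<in>DG_edges C T. g (edge_inner a))"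

definition Q_graph :: "'v graph \<Rightarrow> real \<Rightarrow> real set \<Rightarrow> (real ^ 'n) set set" where
  "Q_graph G \<theta> T = {C. spherical_code (card (fst G)) \<theta> C \<and> graph_iso (DG C T) G}"

definition tau :: "real ^ 'n \<Rightarrow> 'v graph \<Rightarrow> real \<Rightarrow> real set \<Rightarrow> (real \<Rightarrow> real) \<Rightarrow> ereal" where
  "tau e G \<theta> T g =
     (SUP C\<in>{C :: (real ^ 'n) set. C \<in> Q_graph G \<theta> T \<and>
         (\<forall>c\<in>C. ereal (\<Sum>c'\<in>C. ext_zero T g (inner c c')) \<le>
            h_val e (graph_degree (DG C T) c) \<theta> T g)}.
       ereal (H_sum g C T))"

end

theory Submission
  imports Defs
begin

text \<open>
  The sum \<open>\<Sum>F(x \<bullet> y, x \<bullet> z, y \<bullet> z)\<close> over \<open>C\<^sup>3\<close> is estimated in two ways. From above, conditions (2) and (3)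
  bound the triples with coinciding and with distinct entries, and the terms \<open>g\<close> add up to
  \<open>6 N H(C, T)\<close>; an isometry moving a point of \<open>C\<close> to \<open>e\<close> shows that every code with the given distance graph
  satisfies the side condition in the definition of \<open>\<tau>\<close>. From below, the sum is at least
  \<open>f\<^sub>0 N\<^sup>3\<close>, because the sums of the matrices \<open>Y\<^sub>k\<close> over pairs of points with a fixed pole are positive
  semidefinite.

  This last fact is Schoenberg's theorem in dimension \<open>m = n - 1\<close>. Instead of integrating over the sphere,
  one deduces Gegenbauer's differential equation from orthogonality. It says that the zonal kernel
  \<open>K\<^sub>y(x) = \<bar>x\<bar>\<^sup>k \<bar>y\<bar>\<^sup>k P\<^sub>k(x \<bullet> y / (\<bar>x\<bar> \<bar>y\<bar>))\<close> is harmonic in \<open>x\<close>. In the Fischer inner product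
  \<open>p(\<partial>) q\<close>, multiplication by \<open>\<bar>x\<bar>\<^sup>2\<close> is adjoint to the Laplacian and \<open>(x \<bullet> y)\<^sup>k\<close> reproduces values at
  \<open>y\<close>. As \<open>K\<^sub>y(x) - c (x \<bullet> y)\<^sup>k\<close> is a multiple of \<open>\<bar>x\<bar>\<^sup>2\<close>, with \<open>c\<close> the leading coefficient of \<open>P\<^sub>k\<close>, the
  kernel \<open>K\<^sub>y(x)\<close> is up to a positive factor the Fischer product of \<open>K\<^sub>x\<close> and \<open>K\<^sub>y\<close>, hence positive
  semidefinite.
\<close>

no_notation Matrix.scalar_prod (infix \<open>\<bullet>\<close> 70)

section \<open>The Fischer form\<close>

definition dir_deriv :: "'a::real_normed_vector \<Rightarrow> ('a \<Rightarrow> real) \<Rightarrow> 'a \<Rightarrow> real" where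
  "dir_deriv b p x = deriv (\<lambda>t. p (x + t *\<^sub>R b)) 0"

lemma dir_derivI:
  "((\<lambda>t. p (x + t *\<^sub>R b)) has_real_derivative d) (at 0) \<Longrightarrow> dir_deriv b p x = d"
  unfolding dir_deriv_def by (rule DERIV_imp_deriv)

lemma has_dir_derivI:
  "((\<lambda>t. p (x + t *\<^sub>R b)) has_real_derivative d) (at 0) \<Longrightarrow>
    ((\<lambda>t. p (x + t *\<^sub>R b)) has_real_derivative dir_deriv b p x) (at 0)"
  using dir_derivI by blast

lemma has_dir_deriv:
  "real_polynomial_function p \<Longrightarrow>
    ((\<lambda>t. p (x + t *\<^sub>R b)) has_real_derivative dir_deriv b p x) (at 0)"
proof (induction p rule: real_polynomial_function.induct)
  case (linear f)
  then interpret bounded_linear f .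
  have "((\<lambda>t. f (x + t *\<^sub>R b)) has_real_derivative f b) (at 0)"
    by (auto simp: add scaleR intro!: derivative_eq_intros)
  then show ?case by (rule has_dir_derivI)
next
  case (const c)
  have "((\<lambda>t. c) has_real_derivative 0) (at 0)" by simp
  then show ?case by (rule has_dir_derivI)
next
  case (add f g)
  from DERIV_add[OF add.IH] show ?case by (rule has_dir_derivI)
next
  case (mult f g)
  from DERIV_mult[OF mult.IH] show ?case by (rule has_dir_derivI)
qed

lemma dir_deriv_linear: "bounded_linear f \<Longrightarrow> dir_deriv b f x = f b"
proof -
  assume "bounded_linear f"
  then interpret bounded_linear f .
  show ?thesis
    by (rule dir_derivI) (auto simp: add scaleR intro!: derivative_eq_intros)
qed

lemma dir_deriv_const [simp]: "dir_deriv b (\<lambda>x. c) = (\<lambda>x. 0)"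
  by (rule ext, rule dir_derivI) simp

lemma dir_deriv_inner_left: "dir_deriv b (\<lambda>x. x \<bullet> y) = (\<lambda>x. b \<bullet> y)"
  by (rule ext) (rule dir_deriv_linear[OF bounded_linear_inner_left])

lemma dir_deriv_add:
  assumes "real_polynomial_function p" "real_polynomial_function q"
  shows "dir_deriv b (\<lambda>x. p x + q x) = (\<lambda>x. dir_deriv b p x + dir_deriv b q x)"
  by (rule ext, rule dir_derivI) (intro DERIV_add has_dir_deriv assms)

lemma dir_deriv_mult:
  assumes "real_polynomial_function p" "real_polynomial_function q"
  shows "dir_deriv b (\<lambda>x. p x * q x) = (\<lambda>x. dir_deriv b p x * q x + p x * dir_deriv b q x)"
proof (rule ext, rule dir_derivI)
  fix x
  show "((\<lambda>t. p (x + t *\<^sub>R b) * q (x + t *\<^sub>R b)) has_real_derivative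
      dir_deriv b p x * q x + p x * dir_deriv b q x) (at 0)"
    using DERIV_mult[OF has_dir_deriv[OF assms(1)] has_dir_deriv[OF assms(2)]]
    by (simp add: mult.commute)
qed

lemma dir_deriv_cmult:
  assumes "real_polynomial_function p"
  shows "dir_deriv b (\<lambda>x. c * p x) = (\<lambda>x. c * dir_deriv b p x)"
  using dir_deriv_mult[OF real_polynomial_function.intros(2) assms, of b c] by simp

lemma dir_deriv_sum:
  assumes "\<And>i. i \<in> I \<Longrightarrow> real_polynomial_function (p i)"
  shows "dir_deriv b (\<lambda>x. \<Sum>i\<in>I. p i x) = (\<lambda>x. \<Sum>i\<in>I. dir_deriv b (p i) x)"
proof (rule ext, rule dir_derivI)
  fix x
  show "((\<lambda>t. \<Sum>i\<in>I. p i (x + t *\<^sub>R b)) has_real_derivative (\<Sum>i\<in>I. dir_deriv b (p i) x)) (at 0)"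
    by (intro DERIV_sum has_dir_deriv assms)
qed

lemma dir_deriv_power:
  assumes "real_polynomial_function p"
  shows "dir_deriv b (\<lambda>x. p x ^ k) = (\<lambda>x. real k * p x ^ (k - 1) * dir_deriv b p x)"
proof (rule ext, rule dir_derivI)
  fix x
  show "((\<lambda>t. p (x + t *\<^sub>R b) ^ k) has_real_derivative
      real k * p x ^ (k - 1) * dir_deriv b p x) (at 0)"
    using DERIV_power[OF has_dir_deriv[OF assms], of x b k] by (simp add: mult_ac)
qed

lemma real_polynomial_function_dir_deriv:
  "real_polynomial_function p \<Longrightarrow> real_polynomial_function (dir_deriv b p)"
proof (induction p rule: real_polynomial_function.induct)
  case (linear f)
  then have "dir_deriv b f = (\<lambda>x. f b)" using dir_deriv_linear by blast
  then show ?case by (simp add: real_polynomial_function.intros(2))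
next
  case (const c)
  then show ?case by (simp add: real_polynomial_function.intros(2))
next
  case (add f g)
  then show ?case by (simp add: dir_deriv_add real_polynomial_function.intros(3))
next
  case (mult f g)
  then show ?case
    by (simp add: dir_deriv_mult real_polynomial_function.intros(3) real_polynomial_function.intros(4))
qed

lemmas rpf_intros = real_polynomial_function.intros(2) real_polynomial_function.intros(3)
  real_polynomial_function.intros(4) real_polynomial_function_power real_polynomial_function_sum
  real_polynomial_function_dir_deriv real_polynomial_function.intros(1)[OF bounded_linear_inner_left]

lemma dir_deriv_commute:
  "real_polynomial_function p \<Longrightarrow> dir_deriv a (dir_deriv b p) = dir_deriv b (dir_deriv a p)"
proof (induction p rule: real_polynomial_function.induct)
  case (linear f)
  then have "dir_deriv b f = (\<lambda>x. f b)" for b using dir_deriv_linear by blast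
  then show ?case by simp
next
  case (mult f g)
  then show ?case
    by (simp add: dir_deriv_mult dir_deriv_add rpf_intros algebra_simps)
qed (simp_all add: dir_deriv_add rpf_intros)

lemma dir_deriv_sum_direction:
  assumes "real_polynomial_function p" "finite S"
  shows "dir_deriv (\<Sum>b\<in>S. c b *\<^sub>R b) p x = (\<Sum>b\<in>S. c b * dir_deriv b p x)"
  using assms(1)
proof (induction p rule: real_polynomial_function.induct)
  case (linear f)
  then interpret bounded_linear f .
  show ?case
    by (simp add: dir_deriv_linear[OF \<open>bounded_linear f\<close>] sum scaleR)
qed (simp_all add: dir_deriv_add dir_deriv_mult sum.distrib sum_distrib_left sum_distrib_right algebra_simps)

lemma dir_deriv_homogeneous:
  assumes p: "real_polynomial_function p" and hom: "\<And>t x. t \<noteq> 0 \<Longrightarrow> p (t *\<^sub>R x) = t ^ Suc k * p x"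
    and t: "t \<noteq> 0"
  shows "dir_deriv b p (t *\<^sub>R x) = t ^ k * dir_deriv b p x"
proof (rule dir_derivI)
  have "((\<lambda>s. p (x + s *\<^sub>R b)) has_real_derivative dir_deriv b p x) (at ((1 / t) * 0))"
    using has_dir_deriv[OF p] by simp
  then have "((\<lambda>s. p (x + ((1 / t) * s) *\<^sub>R b)) has_real_derivative dir_deriv b p x * (1 / t)) (at 0)"
    by (rule DERIV_chain2) (rule DERIV_cmult_Id)
  then have "((\<lambda>s. t ^ Suc k * p (x + ((1 / t) * s) *\<^sub>R b)) has_real_derivative
      t ^ Suc k * (dir_deriv b p x * (1 / t))) (at 0)"
    by (rule DERIV_cmult)
  moreover have "t ^ Suc k * p (x + ((1 / t) * s) *\<^sub>R b) = p (t *\<^sub>R x + s *\<^sub>R b)" for s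
    using hom[OF t, of "x + ((1 / t) * s) *\<^sub>R b"] t by (simp add: algebra_simps)
  ultimately show "((\<lambda>s. p (t *\<^sub>R x + s *\<^sub>R b)) has_real_derivative t ^ k * dir_deriv b p x) (at 0)"
    using t by simp
qed

lemma dir_deriv_euler:
  assumes p: "real_polynomial_function p" and hom: "\<And>t x. t \<noteq> 0 \<Longrightarrow> p (t *\<^sub>R x) = t ^ k * p x"
  shows "dir_deriv x p x = real k * p x"
proof (rule dir_derivI)
  have "((\<lambda>t. (1 + t) ^ k * p x) has_real_derivative real k * p x) (at 0)"
    by (auto intro!: derivative_eq_intros)
  moreover have "eventually (\<lambda>t. t \<in> {-1<..}) (nhds (0::real))"
    by (rule eventually_nhds_in_open) auto
  then have "eventually (\<lambda>t. p (x + t *\<^sub>R x) = (1 + t) ^ k * p x) (nhds 0)"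
  proof eventually_elim
    case (elim t)
    then show ?case using hom[of "1 + t" x] by (simp add: algebra_simps)
  qed
  ultimately show "((\<lambda>t. p (x + t *\<^sub>R x)) has_real_derivative real k * p x) (at 0)"
    by (subst DERIV_cong_ev[OF refl _ refl]) auto
qed

text \<open>
  On homogeneous polynomials of degree \<open>k\<close> this is \<open>k!\<close> times the Fischer inner product. The form is
  defined on arbitrary functions, where \<open>dir_deriv\<close> may be a junk value; the lemmas below
  therefore assume polynomials unless the identity is formal.
\<close>

primrec fischer ::
  "'a::real_normed_vector set \<Rightarrow> nat \<Rightarrow> ('a \<Rightarrow> real) \<Rightarrow> ('a \<Rightarrow> real) \<Rightarrow> real" where
  "fischer S 0 p q = p 0 * q 0"
| "fischer S (Suc k) p q = (\<Sum>b\<in>S. fischer S k (dir_deriv b p) (dir_deriv b q))"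

lemma fischer_features:
  fixes S :: "'a::real_normed_vector set"
  assumes "finite S"
  shows "\<exists>(L :: 'a list set) \<phi>. finite L \<and>
    (\<forall>p q. fischer S k p q = (\<Sum>l\<in>L. \<phi> l p * \<phi> l q))"
proof (induction k)
  case 0
  show ?case by (intro exI[of _ "{[]}"] exI[of _ "\<lambda>l p. p 0"]) simp
next
  case (Suc k)
  then obtain L :: "'a list set" and \<phi> where L: "finite L"
    and \<phi>: "\<And>p q. fischer S k p q = (\<Sum>l\<in>L. \<phi> l p * \<phi> l q)" by blast
  let ?h = "\<lambda>(b, l). b # l" and ?\<psi> = "\<lambda>l p. \<phi> (tl l) (dir_deriv (hd l) p)"
  have "fischer S (Suc k) p q = (\<Sum>l\<in>?h ` (S \<times> L). ?\<psi> l p * ?\<psi> l q)" for p q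
  proof -
    have "inj_on ?h (S \<times> L)" by (auto simp: inj_on_def)
    then have "(\<Sum>l\<in>?h ` (S \<times> L). ?\<psi> l p * ?\<psi> l q) =
        (\<Sum>z\<in>S \<times> L. ?\<psi> (?h z) p * ?\<psi> (?h z) q)"
      by (simp only: sum.reindex o_def)
    also have "\<dots> = (\<Sum>b\<in>S. \<Sum>l\<in>L. ?\<psi> (?h (b, l)) p * ?\<psi> (?h (b, l)) q)"
      unfolding sum.cartesian_product by (rule sum.cong) auto
    finally show ?thesis by (simp only: \<phi> fischer.simps prod.case list.sel)
  qed
  moreover have "finite (?h ` (S \<times> L))" using L assms by (intro finite_imageI finite_cartesian_product)
  ultimately show ?case by (intro exI[of _ "?h ` (S \<times> L)"] exI[of _ ?\<psi>]) blast
qed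

lemma fischer_zero_left [simp]: "fischer S k (\<lambda>x. 0) q = 0"
  by (induction k arbitrary: q) simp_all

lemma fischer_add_left:
  "\<lbrakk>real_polynomial_function p; real_polynomial_function p'\<rbrakk> \<Longrightarrow>
    fischer S k (\<lambda>x. p x + p' x) q = fischer S k p q + fischer S k p' q"
  by (induction k arbitrary: p p' q) (simp_all add: algebra_simps dir_deriv_add rpf_intros sum.distrib)

lemma fischer_cmult_left:
  "real_polynomial_function p \<Longrightarrow> fischer S k (\<lambda>x. c * p x) q = c * fischer S k p q"
  by (induction k arbitrary: p q) (simp_all add: dir_deriv_cmult rpf_intros sum_distrib_left)

lemma fischer_sum_left:
  assumes "\<And>i. i \<in> I \<Longrightarrow> real_polynomial_function (p i)" "finite I"
  shows "fischer S k (\<lambda>x. \<Sum>i\<in>I. p i x) q = (\<Sum>i\<in>I. fischer S k (p i) q)"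
  using assms(2,1) by (induction I) (simp_all add: fischer_add_left rpf_intros)

lemma fischer_commute: "fischer S k p q = fischer S k q p"
  by (induction k arbitrary: p q) (simp_all add: mult.commute)

lemma fischer_add_right:
  "\<lbrakk>real_polynomial_function p; real_polynomial_function p'\<rbrakk> \<Longrightarrow>
    fischer S k q (\<lambda>x. p x + p' x) = fischer S k q p + fischer S k q p'"
  by (simp add: fischer_commute[of S k q] fischer_add_left)

lemma fischer_cmult_right:
  "real_polynomial_function p \<Longrightarrow> fischer S k q (\<lambda>x. c * p x) = c * fischer S k q p"
  by (simp add: fischer_commute[of S k q] fischer_cmult_left)

lemma fischer_sum_right:
  assumes "\<And>i. i \<in> I \<Longrightarrow> real_polynomial_function (p i)" "finite I"
  shows "fischer S k q (\<lambda>x. \<Sum>i\<in>I. p i x) = (\<Sum>i\<in>I. fischer S k q (p i))"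
  using assms by (simp add: fischer_commute[of S k q] fischer_sum_left)

locale orthonormal_set =
  fixes S :: "'a::real_inner set"
  assumes finite_S: "finite S"
    and inner_S: "\<And>a b. a \<in> S \<Longrightarrow> b \<in> S \<Longrightarrow> a \<bullet> b = (if a = b then 1 else 0)"
begin

lemma fischer_coordinate_mult:
  assumes "real_polynomial_function p" "real_polynomial_function r" "b \<in> S"
  shows "fischer S (Suc k) p (\<lambda>x. (x \<bullet> b) * r x) = real (Suc k) * fischer S k (dir_deriv b p) r"
  using assms(1,2)
proof (induction k arbitrary: p r)
  case 0
  have "fischer S (Suc 0) p (\<lambda>x. (x \<bullet> b) * r x) = (\<Sum>a\<in>S. dir_deriv a p 0 * (a \<bullet> b) * r 0)"
    using 0 by (simp add: dir_deriv_mult dir_deriv_inner_left rpf_intros mult.assoc)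
  also have "\<dots> = (\<Sum>a\<in>S. if a = b then dir_deriv a p 0 * r 0 else 0)"
    using \<open>b \<in> S\<close> by (intro sum.cong refl) (simp add: inner_S)
  also have "\<dots> = dir_deriv b p 0 * r 0"
    using \<open>b \<in> S\<close> finite_S by simp
  finally show ?case by simp
next
  case (Suc k)
  have "fischer S (Suc (Suc k)) p (\<lambda>x. (x \<bullet> b) * r x) =
      (\<Sum>a\<in>S. fischer S (Suc k) (dir_deriv a p) (\<lambda>x. (a \<bullet> b) * r x + (x \<bullet> b) * dir_deriv a r x))"
    unfolding fischer.simps(2)[of S "Suc k"]
    using Suc.prems by (simp add: dir_deriv_mult dir_deriv_inner_left rpf_intros)
  also have "\<dots> = (\<Sum>a\<in>S. (a \<bullet> b) * fischer S (Suc k) (dir_deriv a p) r +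
      real (Suc k) * fischer S k (dir_deriv b (dir_deriv a p)) (dir_deriv a r))"
    using Suc.prems
    by (intro sum.cong refl)
      (simp only: fischer_add_right fischer_cmult_right Suc.IH rpf_intros)
  also have "\<dots> = (\<Sum>a\<in>S. if a = b then fischer S (Suc k) (dir_deriv a p) r else 0) +
      real (Suc k) * (\<Sum>a\<in>S. fischer S k (dir_deriv a (dir_deriv b p)) (dir_deriv a r))"
    using \<open>b \<in> S\<close> unfolding sum.distrib sum_distrib_left dir_deriv_commute[OF Suc.prems(1), of b]
    by (intro arg_cong2[where f = "(+)"] sum.cong refl) (simp_all add: inner_S)
  also have "\<dots> = real (Suc (Suc k)) * fischer S (Suc k) (dir_deriv b p) r"
    using \<open>b \<in> S\<close> finite_S by (simp add: distrib_right)
  finally show ?case .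
qed

definition sqnorm :: "'a \<Rightarrow> real" where
  "sqnorm x = (\<Sum>b\<in>S. (x \<bullet> b)\<^sup>2)"

definition laplace :: "('a \<Rightarrow> real) \<Rightarrow> 'a \<Rightarrow> real" where
  "laplace p x = (\<Sum>b\<in>S. dir_deriv b (dir_deriv b p) x)"

lemma rpf_sqnorm: "real_polynomial_function sqnorm"
  unfolding sqnorm_def[abs_def] by (intro rpf_intros finite_S)

lemma fischer_sqnorm_mult:
  assumes p: "real_polynomial_function p" and r: "real_polynomial_function r"
  shows "fischer S (Suc (Suc k)) p (\<lambda>x. sqnorm x * r x) =
    real (Suc (Suc k)) * real (Suc k) * fischer S k (laplace p) r"
proof -
  have "fischer S (Suc (Suc k)) p (\<lambda>x. sqnorm x * r x) =
      fischer S (Suc (Suc k)) p (\<lambda>x. \<Sum>b\<in>S. (x \<bullet> b) * ((x \<bullet> b) * r x))"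
    by (simp add: sqnorm_def sum_distrib_right power2_eq_square mult.assoc)
  also have "\<dots> = (\<Sum>b\<in>S. fischer S (Suc (Suc k)) p (\<lambda>x. (x \<bullet> b) * ((x \<bullet> b) * r x)))"
    using r finite_S by (intro fischer_sum_right) (auto intro!: rpf_intros)
  also have "\<dots> = (\<Sum>b\<in>S. real (Suc (Suc k)) * real (Suc k) *
      fischer S k (dir_deriv b (dir_deriv b p)) r)"
    using p r by (intro sum.cong refl)
      (simp only: fischer_coordinate_mult rpf_intros mult.assoc)
  also have "\<dots> = real (Suc (Suc k)) * real (Suc k) * fischer S k (laplace p) r"
    unfolding laplace_def[abs_def] using p finite_S
    by (simp add: fischer_sum_left rpf_intros sum_distrib_left)
  finally show ?thesis .
qed

text \<open>Homogeneity is only assumed for \<open>t \<noteq> 0\<close>, since only this version passes to derivatives.\<close>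

lemma fischer_inner_power:
  assumes p: "real_polynomial_function p" and hom: "\<And>t x. t \<noteq> 0 \<Longrightarrow> p (t *\<^sub>R x) = t ^ k * p x"
    and y: "y = (\<Sum>b\<in>S. (y \<bullet> b) *\<^sub>R b)"
  shows "fischer S k p (\<lambda>x. (x \<bullet> y) ^ k) = (fact k)\<^sup>2 * p y"
  using p hom
proof (induction k arbitrary: p)
  case 0
  have "((\<lambda>t. p (0 + t *\<^sub>R y)) \<longlongrightarrow> p (0 + 0 *\<^sub>R y)) (at 0)"
    using DERIV_isCont[OF has_dir_deriv[OF 0(1), of 0 y]] unfolding isCont_def .
  moreover have "eventually (\<lambda>t. p (0 + t *\<^sub>R y) = p y) (at 0)"
    using 0(2)[of _ y] by (auto simp: eventually_at intro!: exI[of _ 1])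
  ultimately have "((\<lambda>t::real. p y) \<longlongrightarrow> p 0) (at 0)"
    by (simp add: tendsto_cong)
  then have "p 0 = p y" using tendsto_const_iff[of "at (0::real)"] by (metis trivial_limit_at)
  then show ?case by simp
next
  case (Suc k)
  have "(\<lambda>x. (x \<bullet> y) ^ Suc k) = (\<lambda>x. \<Sum>b\<in>S. (y \<bullet> b) * ((x \<bullet> b) * (x \<bullet> y) ^ k))"
  proof
    fix x
    have "x \<bullet> y = (\<Sum>b\<in>S. (y \<bullet> b) * (x \<bullet> b))"
      by (subst y) (simp add: inner_sum_right)
    then show "(x \<bullet> y) ^ Suc k = (\<Sum>b\<in>S. (y \<bullet> b) * ((x \<bullet> b) * (x \<bullet> y) ^ k))"
      by (simp add: sum_distrib_right mult.assoc)
  qed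
  then have "fischer S (Suc k) p (\<lambda>x. (x \<bullet> y) ^ Suc k) =
      (\<Sum>b\<in>S. fischer S (Suc k) p (\<lambda>x. (y \<bullet> b) * ((x \<bullet> b) * (x \<bullet> y) ^ k)))"
    using finite_S by (simp only:) (intro fischer_sum_right rpf_intros)
  also have "\<dots> = (\<Sum>b\<in>S. (y \<bullet> b) * (real (Suc k) *
      fischer S k (dir_deriv b p) (\<lambda>x. (x \<bullet> y) ^ k)))"
    using Suc.prems(1) by (intro sum.cong refl)
      (simp only: fischer_cmult_right fischer_coordinate_mult rpf_intros)
  also have "\<dots> = (\<Sum>b\<in>S. (y \<bullet> b) * (real (Suc k) * ((fact k)\<^sup>2 * dir_deriv b p y)))"
  proof -
    have "fischer S k (dir_deriv b p) (\<lambda>x. (x \<bullet> y) ^ k) = (fact k)\<^sup>2 * dir_deriv b p y" for b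
      using Suc.prems
      by (intro Suc.IH real_polynomial_function_dir_deriv dir_deriv_homogeneous) blast+
    then show ?thesis by simp
  qed
  also have "\<dots> = real (Suc k) * (fact k)\<^sup>2 * (\<Sum>b\<in>S. (y \<bullet> b) * dir_deriv b p y)"
    by (simp add: sum_distrib_left mult_ac)
  also have "(\<Sum>b\<in>S. (y \<bullet> b) * dir_deriv b p y) = dir_deriv y p y"
    using dir_deriv_sum_direction[OF Suc.prems(1) finite_S, of "\<lambda>b. y \<bullet> b" y]
    by (simp only: y[symmetric])
  also have "dir_deriv y p y = real (Suc k) * p y"
    using Suc.prems by (rule dir_deriv_euler)
  finally show ?case by (simp add: power2_eq_square mult_ac)
qed

end


section \<open>The differential equation of the Gegenbauer polynomials\<close>

definition gegenbauer_op :: "nat \<Rightarrow> real poly \<Rightarrow> real poly" where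
  "gegenbauer_op m p =
    [:1, 0, -1:] * pderiv (pderiv p) - Polynomial.smult (real m - 1) ([:0, 1:] * pderiv p)"

lemma coeff_gegenbauer_op:
  "coeff (gegenbauer_op m p) l =
    real (l + 2) * real (l + 1) * coeff p (l + 2) - real l * (real l + real m - 2) * coeff p l"
proof -
  have "[:1, 0, -1:] * q = q - pCons 0 (pCons 0 q)" for q :: "real poly"
    by simp
  then show ?thesis
    unfolding gegenbauer_op_def
    by (cases l; cases "l - 1") (auto simp: coeff_pderiv coeff_pCons algebra_simps split: nat.splits)
qed

lemma gegenbauer_op_self_adjoint:
  assumes m: "m \<ge> 2"
  shows "gegenbauer_int m (gegenbauer_op m p * q) = gegenbauer_int m (p * gegenbauer_op m q)"
proof -
  define v where "v = pderiv p * q - p * pderiv q"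
  define W where "W t = (1 - t\<^sup>2) powr ((real m - 1) / 2) * poly v t" for t :: real
  define f where "f = gegenbauer_op m p * q - p * gegenbauer_op m q"
  have pf: "poly f t = (1 - t\<^sup>2) * poly (pderiv v) t - (real m - 1) * t * poly v t" for t
    by (simp add: f_def v_def gegenbauer_op_def pderiv_mult pderiv_diff algebra_simps power2_eq_square)
  have "((\<lambda>t. poly f t * gegenbauer_weight m t) has_integral (W 1 - W (-1))) {-1..1}"
  proof (rule fundamental_theorem_of_calculus_interior)
    have nn: "0 \<le> 1 - t\<^sup>2" if "t \<in> {-1..1}" for t :: real
      using that by (auto simp: abs_square_le_1)
    show "continuous_on {-1..1} W"
      unfolding W_def using m nn by (intro continuous_intros continuous_on_powr') auto
    fix t :: real assume t: "t \<in> {-1<..<1}"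
    then have pos: "1 - t\<^sup>2 > 0" by (auto simp: abs_square_less_1)
    have e: "(1 - t\<^sup>2) powr ((real m - 1) / 2) = (1 - t\<^sup>2) * (1 - t\<^sup>2) powr ((real m - 3) / 2)"
      using pos powr_add[of "1 - t\<^sup>2" 1 "(real m - 3) / 2"] by (simp add: field_simps)
    have e': "(1 - t\<^sup>2) powr ((real m - 1) / 2 - 1) = (1 - t\<^sup>2) powr ((real m - 3) / 2)"
      by (intro arg_cong[where f = "(powr) (1 - t\<^sup>2)"]) (simp add: field_simps)
    have "((\<lambda>t. (1 - t\<^sup>2) powr ((real m - 1) / 2)) has_real_derivative
        (real m - 1) / 2 * (1 - t\<^sup>2) powr ((real m - 1) / 2 - 1) * (- 2 * t)) (at t)"
      using pos by (auto intro!: derivative_eq_intros)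
    then have "(W has_real_derivative poly f t * gegenbauer_weight m t) (at t)"
      unfolding W_def
      by (rule DERIV_cong[OF DERIV_mult[OF _ poly_DERIV]])
        (simp add: pf gegenbauer_weight_def e e' field_simps)
    then show "(W has_vector_derivative poly f t * gegenbauer_weight m t) (at t)"
      by (simp add: has_real_derivative_iff_has_vector_derivative)
  qed simp
  moreover have "W 1 = 0" "W (-1) = 0" by (simp_all add: W_def)
  ultimately have "gegenbauer_int m f = 0"
    unfolding gegenbauer_int_def by (simp add: integral_unique)
  then show ?thesis by (simp add: f_def gegenbauer_int_diff[OF m])
qed

lemma degree_gegenbauer: "m \<ge> 2 \<Longrightarrow> degree (gegenbauer m k) = k"
  using gegenbauer_family_gegenbauer by (simp add: gegenbauer_family_def)

lemma lead_coeff_gegenbauer_nonzero: "m \<ge> 2 \<Longrightarrow> coeff (gegenbauer m k) k \<noteq> 0"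
proof -
  assume m: "m \<ge> 2"
  have "poly (gegenbauer m k) 1 = 1"
    using gegenbauer_family_gegenbauer[OF m] by (simp add: gegenbauer_family_def)
  then have "gegenbauer m k \<noteq> 0" by auto
  then show ?thesis using degree_gegenbauer[OF m] leading_coeff_neq_0 by metis
qed

lemma gegenbauer_op_gegenbauer:
  assumes m: "m \<ge> 2"
  shows "gegenbauer_op m (gegenbauer m k) =
    Polynomial.smult (- (real k * (real k + real m - 2))) (gegenbauer m k)"
proof -
  let ?P = "gegenbauer m k" and ?L = "gegenbauer_op m (gegenbauer m k)"
  let ?c = "real k * (real k + real m - 2)"
  obtain p where p: "monic_orth m k p" using monic_orth_exists[OF m] by blast
  have orth: "gegenbauer_int m (?P * q) = 0" if "q \<in> low_polys k" for q
    using gegenbauer_family_orth_low[OF m gegenbauer_family_gegenbauer[OF m] that] .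
  have high: "coeff ?P i = 0" if "i > k" for i
    using degree_gegenbauer[OF m] that by (simp add: coeff_eq_0)
  have P: "?P = Polynomial.smult (coeff ?P k) p"
    using high orth by (intro orth_unique[OF m p])
  have lk: "coeff ?L k = - ?c * coeff ?P k"
    using high by (simp add: coeff_gegenbauer_op)
  have "?L = Polynomial.smult (coeff ?L k) p"
  proof (rule orth_unique[OF m p])
    show "coeff ?L i = 0" if "i > k" for i
      using high that by (simp add: coeff_gegenbauer_op)
    fix q assume "q \<in> low_polys k"
    then have "gegenbauer_op m q \<in> low_polys k"
      by (auto simp: low_polys_def coeff_gegenbauer_op)
    then show "gegenbauer_int m (?L * q) = 0"
      by (simp add: gegenbauer_op_self_adjoint[OF m] orth)
  qed
  also have "\<dots> = Polynomial.smult (- ?c) (Polynomial.smult (coeff ?P k) p)"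
    by (simp add: lk)
  finally show ?thesis using P by simp
qed

lemma coeff_gegenbauer_recurrence:
  assumes m: "m \<ge> 2"
  shows "real (l + 2) * real (l + 1) * coeff (gegenbauer m k) (l + 2) =
    - ((real k - real l) * (real k + real l + real m - 2)) * coeff (gegenbauer m k) l"
  using arg_cong[OF gegenbauer_op_gegenbauer[OF m], of "\<lambda>p. coeff p l" k]
  by (simp add: coeff_gegenbauer_op algebra_simps)


section \<open>Positive definiteness of the zonal kernels\<close>

context orthonormal_set
begin

definition gegenbauer_kernel :: "nat \<Rightarrow> nat \<Rightarrow> 'a \<Rightarrow> 'a \<Rightarrow> real" where
  "gegenbauer_kernel m k x y =
    (\<Sum>l\<le>k. coeff (gegenbauer m k) l * (x \<bullet> y) ^ l * (sqnorm x * sqnorm y) ^ ((k - l) div 2))"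

lemma gegenbauer_kernel_commute: "gegenbauer_kernel m k x y = gegenbauer_kernel m k y x"
  by (simp add: gegenbauer_kernel_def inner_commute mult.commute)

lemma rpf_gegenbauer_kernel: "real_polynomial_function (\<lambda>x. gegenbauer_kernel m k x y)"
  unfolding gegenbauer_kernel_def by (intro rpf_intros rpf_sqnorm finite_atMost)

lemma sqnorm_scaleR: "sqnorm (t *\<^sub>R x) = t\<^sup>2 * sqnorm x"
  by (simp add: sqnorm_def sum_distrib_left power_mult_distrib)

lemma gegenbauer_kernel_scaleR:
  assumes m: "m \<ge> 2"
  shows "gegenbauer_kernel m k (t *\<^sub>R x) y = t ^ k * gegenbauer_kernel m k x y"
  unfolding gegenbauer_kernel_def sum_distrib_left
proof (rule sum.cong[OF refl])
  fix l assume l: "l \<in> {..k}"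
  show "coeff (gegenbauer m k) l * (t *\<^sub>R x \<bullet> y) ^ l * (sqnorm (t *\<^sub>R x) * sqnorm y) ^ ((k - l) div 2) =
      t ^ k * (coeff (gegenbauer m k) l * (x \<bullet> y) ^ l * (sqnorm x * sqnorm y) ^ ((k - l) div 2))"
  proof (cases "odd (k + l)")
    case True
    then show ?thesis using coeff_gegenbauer_odd[OF m] by simp
  next
    case False
    moreover from l have "l \<le> k" by simp
    ultimately have "k = l + 2 * ((k - l) div 2)" by presburger
    then have "t ^ k = t ^ l * (t\<^sup>2) ^ ((k - l) div 2)" by (metis power_add power_mult)
    then show ?thesis by (simp add: sqnorm_scaleR power_mult_distrib)
  qed
qed

lemma dir_deriv_sqnorm:
  assumes "b \<in> S"
  shows "dir_deriv b sqnorm = (\<lambda>x. 2 * (x \<bullet> b))"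
proof
  fix x
  have "dir_deriv b (\<lambda>x. \<Sum>a\<in>S. (x \<bullet> a)\<^sup>2) x = (\<Sum>a\<in>S. 2 * (x \<bullet> a) * (b \<bullet> a))"
    by (subst dir_deriv_sum) (auto intro!: rpf_intros simp: dir_deriv_power dir_deriv_inner_left rpf_intros)
  also have "\<dots> = (\<Sum>a\<in>S. if a = b then 2 * (x \<bullet> a) else 0)"
    using assms by (intro sum.cong refl) (auto simp: inner_S)
  finally show "dir_deriv b sqnorm x = 2 * (x \<bullet> b)"
    using assms finite_S by (simp add: sqnorm_def[abs_def])
qed

lemma laplace_monomial:
  assumes y: "y = (\<Sum>b\<in>S. (y \<bullet> b) *\<^sub>R b)"
  shows "laplace (\<lambda>x. (x \<bullet> y) ^ l * sqnorm x ^ j) x =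
    real l * (real l - 1) * sqnorm y * (x \<bullet> y) ^ (l - 2) * sqnorm x ^ j +
    2 * real j * (2 * real l + real (card S) + 2 * real j - 2) * (x \<bullet> y) ^ l * sqnorm x ^ (j - 1)"
proof -
  let ?s = "x \<bullet> y" and ?q = "sqnorm x"
  have D: "dir_deriv b (dir_deriv b (\<lambda>x. (x \<bullet> y) ^ l * sqnorm x ^ j)) x =
      real l * real (l - 1) * ?s ^ (l - 2) * ?q ^ j * (b \<bullet> y)\<^sup>2 +
      4 * real l * real j * ?s ^ (l - 1) * ?q ^ (j - 1) * ((b \<bullet> y) * (x \<bullet> b)) +
      4 * real j * real (j - 1) * ?s ^ l * ?q ^ (j - 2) * (x \<bullet> b)\<^sup>2 +
      2 * real j * ?s ^ l * ?q ^ (j - 1)" if b: "b \<in> S" for b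
  proof -
    have bb: "b \<bullet> b = 1" using b by (simp add: inner_S)
    show ?thesis
      by (simp add: dir_deriv_mult dir_deriv_add dir_deriv_power dir_deriv_cmult dir_deriv_inner_left
          dir_deriv_sqnorm[OF b] rpf_intros rpf_sqnorm bb power2_eq_square algebra_simps
          numeral_2_eq_2)
  qed
  have s: "(\<Sum>b\<in>S. (b \<bullet> y) * (x \<bullet> b)) = ?s"
    using arg_cong[OF y, of "\<lambda>z. x \<bullet> z"] by (simp add: inner_sum_right inner_commute[of _ y])
  have b: "(\<Sum>b\<in>S. (b \<bullet> y)\<^sup>2) = sqnorm y" by (simp add: sqnorm_def inner_commute)
  have t1: "real l * real (l - 1) * ?s ^ (l - 2) * ?q ^ j * sqnorm y =
      real l * (real l - 1) * ?s ^ (l - 2) * ?q ^ j * sqnorm y"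
    by (cases l) auto
  have t2: "4 * real l * real j * ?s ^ (l - 1) * ?q ^ (j - 1) * ?s =
      4 * real l * real j * ?s ^ l * ?q ^ (j - 1)"
    by (cases l) auto
  have t3: "4 * real j * real (j - 1) * ?s ^ l * ?q ^ (j - 2) * ?q =
      4 * real j * (real j - 1) * ?s ^ l * ?q ^ (j - 1)"
    by (cases j; cases "j - 1") auto
  have "laplace (\<lambda>x. (x \<bullet> y) ^ l * sqnorm x ^ j) x =
      real l * real (l - 1) * ?s ^ (l - 2) * ?q ^ j * sqnorm y +
      4 * real l * real j * ?s ^ (l - 1) * ?q ^ (j - 1) * ?s +
      4 * real j * real (j - 1) * ?s ^ l * ?q ^ (j - 2) * ?q +
      real (card S) * (2 * real j * ?s ^ l * ?q ^ (j - 1))"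
    unfolding laplace_def using D
    by (simp add: sum.distrib sum_distrib_left[symmetric] s b sqnorm_def[of x, symmetric])
  then show ?thesis unfolding t1 t2 t3 by (simp add: algebra_simps)
qed

lemma laplace_gegenbauer_kernel:
  assumes m: "m \<ge> 2" and card: "card S = m" and y: "y = (\<Sum>b\<in>S. (y \<bullet> b) *\<^sub>R b)"
  shows "laplace (\<lambda>x. gegenbauer_kernel m k x y) x = 0"
proof -
  let ?c = "coeff (gegenbauer m k)" and ?s = "x \<bullet> y" and ?q = "sqnorm x" and ?b = "sqnorm y"
  define j where "j l = (k - l) div 2" for l
  \<comment> \<open>The Laplacian of the \<open>l\<close>-th term is \<open>a l - a (l + 2)\<close>, so the sum telescopes.\<close>
  define a where "a l = real l * (real l - 1) * ?c l * ?b ^ Suc (j l) * ?s ^ (l - 2) * ?q ^ j l" for l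
  have high: "?c l = 0" if "l > k" for l
    using degree_gegenbauer[OF m] that by (simp add: coeff_eq_0)
  have "laplace (\<lambda>x. gegenbauer_kernel m k x y) x =
      laplace (\<lambda>x. \<Sum>l\<le>k. (?c l * ?b ^ j l) * ((x \<bullet> y) ^ l * sqnorm x ^ j l)) x"
    by (simp add: gegenbauer_kernel_def j_def power_mult_distrib mult_ac)
  also have "\<dots> = (\<Sum>l\<le>k. (?c l * ?b ^ j l) * laplace (\<lambda>x. (x \<bullet> y) ^ l * sqnorm x ^ j l) x)"
    unfolding laplace_def
    by (simp add: dir_deriv_sum dir_deriv_cmult rpf_intros rpf_sqnorm sum_distrib_left)
      (rule sum.swap)
  also have "\<dots> = (\<Sum>l\<le>k. a l - a (Suc (Suc l)))"
  proof (rule sum.cong[OF refl])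
    fix l assume "l \<in> {..k}"
    then have l: "l \<le> k" by simp
    have 1: "(?c l * ?b ^ j l) * laplace (\<lambda>x. (x \<bullet> y) ^ l * sqnorm x ^ j l) x = a l +
        ?c l * (2 * real (j l) * (2 * real l + real m + 2 * real (j l) - 2)) *
          (?b ^ j l * ?s ^ l * ?q ^ (j l - 1))"
      unfolding laplace_monomial[OF y] card a_def by (simp add: algebra_simps)
    show "(?c l * ?b ^ j l) * laplace (\<lambda>x. (x \<bullet> y) ^ l * sqnorm x ^ j l) x = a l - a (Suc (Suc l))"
    proof (cases "odd (k + l)")
      case True
      then have "?c l = 0" "?c (Suc (Suc l)) = 0" using coeff_gegenbauer_odd[OF m] by simp_all
      then show ?thesis unfolding 1 by (simp add: a_def)
    next
      case False
      then have j2: "2 * j l = k - l" using l by (simp add: j_def)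
      then have rj: "2 * real (j l) = real k - real l" using l by linarith
      show ?thesis
      proof (cases "l = k")
        case True
        then show ?thesis unfolding 1 by (simp add: a_def high j_def)
      next
        case False
        then have jS: "j l = Suc (j (Suc (Suc l)))" using j2 l unfolding j_def by linarith
        have "?c l * (2 * real (j l) * (2 * real l + real m + 2 * real (j l) - 2)) =
            (real k - real l) * (real k + real l + real m - 2) * ?c l"
          unfolding rj by (simp add: algebra_simps)
        also have "\<dots> = - (real (l + 2) * real (l + 1) * ?c (l + 2))"
          using coeff_gegenbauer_recurrence[OF m, of l k] by simp
        finally show ?thesis unfolding 1 by (simp add: a_def jS)
      qed
    qed
  qed
  also have "\<dots> = (\<Sum>l\<le>k. a l) - (\<Sum>l\<le>k. a (Suc (Suc l)))" by (rule sum_subtractf)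
  also have "(\<Sum>l\<le>k. a (Suc (Suc l))) = (\<Sum>l\<le>Suc (Suc k). a l) - a 0 - a 1"
    by (simp only: sum.atMost_Suc_shift) simp
  also have "\<dots> = (\<Sum>l\<le>k. a l)" by (simp add: a_def high)
  finally show ?thesis by simp
qed

lemma fischer_gegenbauer_kernel:
  assumes m: "m \<ge> 2" and card: "card S = m"
    and x: "x = (\<Sum>b\<in>S. (x \<bullet> b) *\<^sub>R b)" and y: "y = (\<Sum>b\<in>S. (y \<bullet> b) *\<^sub>R b)"
  shows "fischer S k (\<lambda>z. gegenbauer_kernel m k z x) (\<lambda>z. gegenbauer_kernel m k z y) =
    coeff (gegenbauer m k) k * (fact k)\<^sup>2 * gegenbauer_kernel m k x y"
proof -
  let ?c = "coeff (gegenbauer m k)" and ?p = "\<lambda>z. gegenbauer_kernel m k z x"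
  define r where "r z = (\<Sum>l<k. ?c l * (z \<bullet> y) ^ l *
    (sqnorm z ^ ((k - l) div 2 - 1) * sqnorm y ^ ((k - l) div 2)))" for z
  have r: "real_polynomial_function r"
    unfolding r_def[abs_def] by (intro rpf_intros rpf_sqnorm) simp
  have split: "gegenbauer_kernel m k z y = ?c k * (z \<bullet> y) ^ k + sqnorm z * r z" for z
  proof -
    have "(\<Sum>l<k. ?c l * (z \<bullet> y) ^ l * (sqnorm z * sqnorm y) ^ ((k - l) div 2)) = sqnorm z * r z"
      unfolding r_def sum_distrib_left
    proof (rule sum.cong[OF refl])
      fix l assume l: "l \<in> {..<k}"
      show "?c l * (z \<bullet> y) ^ l * (sqnorm z * sqnorm y) ^ ((k - l) div 2) =
        sqnorm z * (?c l * (z \<bullet> y) ^ l *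
          (sqnorm z ^ ((k - l) div 2 - 1) * sqnorm y ^ ((k - l) div 2)))"
      proof (cases "odd (k + l)")
        case True
        then show ?thesis using coeff_gegenbauer_odd[OF m] by simp
      next
        case False
        moreover from l have "l < k" by simp
        ultimately have "(k - l) div 2 > 0" by presburger
        then obtain i where "(k - l) div 2 = Suc i" by (metis gr0_conv_Suc)
        then show ?thesis by (simp add: power_mult_distrib)
      qed
    qed
    then show ?thesis
      unfolding gegenbauer_kernel_def by (simp add: lessThan_Suc_atMost[symmetric])
  qed
  have zero: "fischer S k ?p (\<lambda>z. sqnorm z * r z) = 0"
  proof (cases "k \<ge> 2")
    case True
    then obtain i where i: "k = Suc (Suc i)" by (metis add_2_eq_Suc le_Suc_ex)
    have "laplace ?p = (\<lambda>z. 0)" using laplace_gegenbauer_kernel[OF m card x] by blast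
    then show ?thesis
      using fischer_sqnorm_mult[OF rpf_gegenbauer_kernel[of m k x] r, of i] i by simp
  next
    case False
    then consider "k = 0" | "k = 1" by linarith
    then have "r z = 0" for z
      using coeff_gegenbauer_odd[OF m, of 1 0] by cases (simp_all add: r_def)
    then show ?thesis by (simp add: fischer_commute[of S k ?p])
  qed
  have "fischer S k ?p (\<lambda>z. gegenbauer_kernel m k z y) =
      ?c k * fischer S k ?p (\<lambda>z. (z \<bullet> y) ^ k) + fischer S k ?p (\<lambda>z. sqnorm z * r z)"
    unfolding split by (simp only: fischer_add_right fischer_cmult_right rpf_intros rpf_sqnorm r)
  also have "fischer S k ?p (\<lambda>z. (z \<bullet> y) ^ k) = (fact k)\<^sup>2 * gegenbauer_kernel m k y x"
    by (rule fischer_inner_power[OF rpf_gegenbauer_kernel gegenbauer_kernel_scaleR[OF m] y])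
  finally show ?thesis using zero by (simp add: gegenbauer_kernel_commute[of m k x y])
qed

lemma span_expansion:
  assumes "x \<in> span S"
  shows "x = (\<Sum>b\<in>S. (x \<bullet> b) *\<^sub>R b)"
proof -
  have "pairwise Linear_Algebra.orthogonal S"
    by (auto simp: pairwise_def Linear_Algebra.orthogonal_def inner_S)
  moreover have "norm b = 1" if "b \<in> S" for b
    using that by (simp add: norm_eq_sqrt_inner inner_S)
  ultimately show ?thesis using orthonormal_basis_expand assms finite_S by metis
qed

lemma sqnorm_span: "x \<in> span S \<Longrightarrow> sqnorm x = x \<bullet> x"
  using arg_cong[OF span_expansion, of x "\<lambda>z. x \<bullet> z"]
  by (simp add: sqnorm_def inner_sum_right power2_eq_square)

lemma gegenbauer_kernel_features:
  assumes m: "m \<ge> 2" and card: "card S = m"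
  shows "\<exists>(L :: 'a list set) \<phi>. finite L \<and>
    (\<forall>x\<in>span S. \<forall>y\<in>span S. gegenbauer_kernel m k x y = (\<Sum>l\<in>L. \<phi> l x * \<phi> l y))"
proof -
  let ?c = "coeff (gegenbauer m k) k" and ?K = "\<lambda>x z. gegenbauer_kernel m k z x"
  obtain L :: "'a list set" and \<phi> where L: "finite L"
    and \<phi>: "\<And>p q. fischer S k p q = (\<Sum>l\<in>L. \<phi> l p * \<phi> l q)"
    using fischer_features[OF finite_S] by blast
  obtain b where b: "b \<in> S" using card m by fastforce
  have "gegenbauer_kernel m k b b = poly (gegenbauer m k) 1"
  proof -
    have "sqnorm b = (\<Sum>a\<in>S. if a = b then 1 else 0)"
      unfolding sqnorm_def using b by (intro sum.cong refl) (auto simp: inner_S)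
    then have "sqnorm b = 1" using b finite_S by simp
    then show ?thesis
      using b by (simp add: gegenbauer_kernel_def inner_S poly_altdef degree_gegenbauer[OF m])
  qed
  then have "gegenbauer_kernel m k b b = 1"
    using gegenbauer_family_gegenbauer[OF m] by (simp add: gegenbauer_family_def)
  then have "?c * (fact k)\<^sup>2 = fischer S k (?K b) (?K b)"
    using fischer_gegenbauer_kernel[OF m card, of b b k] span_expansion[OF span_base[OF b]] by simp
  also have "\<dots> \<ge> 0" by (simp add: \<phi> sum_nonneg)
  finally have "?c * (fact k)\<^sup>2 \<ge> 0" .
  moreover have "?c \<noteq> 0" by (rule lead_coeff_gegenbauer_nonzero[OF m])
  ultimately have pos: "?c * (fact k)\<^sup>2 > 0" by (simp add: less_le)
  define w where "w = sqrt (?c * (fact k)\<^sup>2)"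
  have w: "w > 0" "w * w = ?c * (fact k)\<^sup>2"
    using pos unfolding w_def by (simp, simp only: real_sqrt_mult_self abs_of_pos)
  have "gegenbauer_kernel m k x y = (\<Sum>l\<in>L. (\<phi> l (?K x) / w) * (\<phi> l (?K y) / w))"
    if "x \<in> span S" "y \<in> span S" for x y
  proof -
    let ?Z = "\<Sum>l\<in>L. \<phi> l (?K x) * \<phi> l (?K y)"
    have "w * w * gegenbauer_kernel m k x y = ?Z"
      using fischer_gegenbauer_kernel[OF m card, of x y k] span_expansion that w(2) by (simp add: \<phi>)
    then have "gegenbauer_kernel m k x y = ?Z / (w * w)"
      using w(1) by (simp add: nonzero_eq_divide_eq mult.commute)
    then show ?thesis by (simp add: sum_divide_distrib)
  qed
  then have "\<forall>x\<in>span S. \<forall>y\<in>span S. gegenbauer_kernel m k x y =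
      (\<Sum>l\<in>L. (\<phi> l (?K x) / w) * (\<phi> l (?K y) / w))" by blast
  with L show ?thesis by (intro exI[of _ L] exI[of _ "\<lambda>l x. \<phi> l (?K x) / w"]) blast
qed

end


section \<open>The lower bound for functions in \<open>BV\<close>\<close>

lemma Y_factor_features:
  fixes e :: "real ^ 'n"
  assumes n: "CARD('n) \<ge> 3" and e: "e \<in> sphere 0 1"
  shows "\<exists>(L :: (real ^ 'n) list set) \<phi>. finite L \<and>
    (\<forall>x\<in>sphere 0 1. \<forall>y\<in>sphere 0 1.
      Y_factor CARD('n) k (e \<bullet> x) (e \<bullet> y) (x \<bullet> y) = (\<Sum>l\<in>L. \<phi> l x * \<phi> l y))"
proof -
  let ?V = "{v. e \<bullet> v = 0}"
  have e1: "e \<bullet> e = 1" using e by (simp add: dot_square_norm)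
  then have e0: "e \<noteq> 0" by auto
  obtain S where S: "pairwise Linear_Algebra.orthogonal S" "\<And>b. b \<in> S \<Longrightarrow> norm b = 1"
    "independent S" "card S = dim ?V" "span S = ?V"
    using orthonormal_basis_subspace[OF subspace_hyperplane, of e] by metis
  have card: "card S = CARD('n) - 1" using S(4) dim_hyperplane[OF e0] by simp
  interpret orthonormal_set S
  proof
    show "finite S" using S(3) by (rule independent_imp_finite)
    fix a b assume "a \<in> S" "b \<in> S"
    then show "a \<bullet> b = (if a = b then 1 else 0)"
      using S(1,2) by (auto simp: pairwise_def Linear_Algebra.orthogonal_def dot_square_norm)
  qed
  obtain L :: "(real ^ 'n) list set" and \<phi> where L: "finite L"
    and \<phi>: "\<And>x y. x \<in> span S \<Longrightarrow> y \<in> span S \<Longrightarrow>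
      gegenbauer_kernel (CARD('n) - 1) k x y = (\<Sum>l\<in>L. \<phi> l x * \<phi> l y)"
    using gegenbauer_kernel_features[of "CARD('n) - 1" k] card n by fastforce
  define P where "P x = x - (e \<bullet> x) *\<^sub>R e" for x
  have P: "P x \<in> span S" for x
    unfolding S(5) by (simp add: P_def inner_diff_right e1)
  have "Y_factor CARD('n) k (e \<bullet> x) (e \<bullet> y) (x \<bullet> y) = (\<Sum>l\<in>L. \<phi> l (P x) * \<phi> l (P y))"
    if "x \<in> sphere 0 1" "y \<in> sphere 0 1" for x y
  proof -
    have PP: "P x \<bullet> P y = x \<bullet> y - (e \<bullet> x) * (e \<bullet> y)" for x y
      by (simp add: P_def inner_diff_left inner_diff_right e1) (simp add: inner_commute)
    have unit: "z \<bullet> z = 1" if "z \<in> sphere 0 1" for z :: "real ^ 'n"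
      using that by (simp add: dot_square_norm)
    have "sqnorm (P x) = 1 - (e \<bullet> x)\<^sup>2" "sqnorm (P y) = 1 - (e \<bullet> y)\<^sup>2"
      using unit that by (simp_all add: sqnorm_span[OF P] PP power2_eq_square)
    then have "Y_factor CARD('n) k (e \<bullet> x) (e \<bullet> y) (x \<bullet> y) =
        gegenbauer_kernel (CARD('n) - 1) k (P x) (P y)"
      by (simp add: Y_factor_def gegenbauer_kernel_def PP)
    then show ?thesis using \<phi>[OF P P] by simp
  qed
  then have "\<forall>x\<in>sphere 0 1. \<forall>y\<in>sphere 0 1. Y_factor CARD('n) k (e \<bullet> x) (e \<bullet> y) (x \<bullet> y) =
      (\<Sum>l\<in>L. \<phi> l (P x) * \<phi> l (P y))" by blast
  with L show ?thesis by (intro exI[of _ L] exI[of _ "\<lambda>l x. \<phi> l (P x)"]) blast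
qed

lemma mat_inner_expand:
  assumes "M \<in> carrier_mat r r" "A \<in> carrier_mat r r"
  shows "mat_inner M A = (\<Sum>i<r. \<Sum>j<r. M $$ (i, j) * A $$ (i, j))"
proof -
  have "mat_inner M A = (\<Sum>i<r. \<Sum>j<r. M $$ (j, i) * A $$ (j, i))"
    using assms unfolding mat_inner_def Let_def
    by (auto simp: scalar_prod_def lessThan_atLeast0 intro!: sum.cong)
  then show ?thesis using sum.swap[of "\<lambda>i j. M $$ (i, j) * A $$ (i, j)"] by simp
qed

lemma psd_carrier: "psd r M \<Longrightarrow> M \<in> carrier_mat r r"
  by (simp add: psd_def)

lemma psd_quadratic_form:
  assumes "psd r M"
  shows "0 \<le> (\<Sum>i<r. \<Sum>j<r. M $$ (i, j) * (v i * v j))"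
proof -
  have M: "M \<in> carrier_mat r r" using assms by (rule psd_carrier)
  have "0 \<le> scalar_prod (vec r v) (M *\<^sub>v vec r v)"
    using assms by (simp add: psd_def)
  also have "\<dots> = (\<Sum>i<r. \<Sum>j<r. M $$ (i, j) * (v i * v j))"
    using M by (auto simp: scalar_prod_def lessThan_atLeast0 sum_distrib_left mult_ac intro!: sum.cong)
  finally show ?thesis .
qed

lemma Y_mat_carrier: "Y_mat n d k x y z \<in> carrier_mat (d - k + 1) (d - k + 1)"
  by (simp add: Y_mat_def)

lemma mat_inner_Y_mat:
  assumes "M \<in> carrier_mat (d - k + 1) (d - k + 1)"
  shows "mat_inner M (Y_mat n d k x y z) =
    (\<Sum>i<d-k+1. \<Sum>j<d-k+1. M $$ (i, j) * (x ^ i * y ^ j)) * Y_factor n k x y z"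
  unfolding mat_inner_expand[OF assms Y_mat_carrier] sum_distrib_right
  by (intro sum.cong refl) (simp add: Y_mat_def)

lemma sum_mat_inner_Y_mat_nonneg:
  fixes e :: "real ^ 'n"
  assumes n: "CARD('n) \<ge> 3" and e: "e \<in> sphere 0 1" and C: "C \<subseteq> sphere 0 1"
    and M: "psd (d - k + 1) M"
  shows "0 \<le> (\<Sum>x\<in>C. \<Sum>y\<in>C. mat_inner M (Y_mat CARD('n) d k (e \<bullet> x) (e \<bullet> y) (x \<bullet> y)))"
proof -
  let ?r = "d - k + 1"
  obtain L :: "(real ^ 'n) list set" and \<phi> where
    \<phi>: "\<And>x y. x \<in> sphere 0 1 \<Longrightarrow> y \<in> sphere 0 1 \<Longrightarrow>
      Y_factor CARD('n) k (e \<bullet> x) (e \<bullet> y) (x \<bullet> y) = (\<Sum>l\<in>L. \<phi> l x * \<phi> l y)"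
    using Y_factor_features[OF n e, of k] by blast
  define v where "v l i = (\<Sum>x\<in>C. (e \<bullet> x) ^ i * \<phi> l x)" for l i
  have vv: "v l i * v l j = (\<Sum>x\<in>C. \<Sum>y\<in>C. ((e \<bullet> x) ^ i * (e \<bullet> y) ^ j) * (\<phi> l x * \<phi> l y))" for l i j
    unfolding v_def sum_product by (intro sum.cong refl) simp
  have "(\<Sum>x\<in>C. \<Sum>y\<in>C. mat_inner M (Y_mat CARD('n) d k (e \<bullet> x) (e \<bullet> y) (x \<bullet> y))) =
      (\<Sum>x\<in>C. \<Sum>y\<in>C. \<Sum>l\<in>L. \<Sum>i<?r. \<Sum>j<?r.
        M $$ (i, j) * (((e \<bullet> x) ^ i * (e \<bullet> y) ^ j) * (\<phi> l x * \<phi> l y)))"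
  proof (intro sum.cong refl)
    fix x y assume "x \<in> C" "y \<in> C"
    then have "mat_inner M (Y_mat CARD('n) d k (e \<bullet> x) (e \<bullet> y) (x \<bullet> y)) =
        (\<Sum>i<?r. \<Sum>j<?r. M $$ (i, j) * ((e \<bullet> x) ^ i * (e \<bullet> y) ^ j)) * (\<Sum>l\<in>L. \<phi> l x * \<phi> l y)"
      using C by (subst mat_inner_Y_mat[OF psd_carrier[OF M]], subst \<phi>) auto
    then show "mat_inner M (Y_mat CARD('n) d k (e \<bullet> x) (e \<bullet> y) (x \<bullet> y)) =
        (\<Sum>l\<in>L. \<Sum>i<?r. \<Sum>j<?r. M $$ (i, j) * (((e \<bullet> x) ^ i * (e \<bullet> y) ^ j) * (\<phi> l x * \<phi> l y)))"
      by (simp only: sum_distrib_left) (simp only: sum_distrib_right mult.assoc)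
  qed
  also have "\<dots> = (\<Sum>l\<in>L. \<Sum>x\<in>C. \<Sum>y\<in>C. \<Sum>i<?r. \<Sum>j<?r.
        M $$ (i, j) * (((e \<bullet> x) ^ i * (e \<bullet> y) ^ j) * (\<phi> l x * \<phi> l y)))"
    by (subst (2) sum.swap, subst sum.swap) (rule refl)
  also have "\<dots> = (\<Sum>l\<in>L. \<Sum>i<?r. \<Sum>j<?r. M $$ (i, j) * (v l i * v l j))"
  proof (rule sum.cong[OF refl])
    fix l
    let ?f = "\<lambda>x y i j. M $$ (i, j) * (((e \<bullet> x) ^ i * (e \<bullet> y) ^ j) * (\<phi> l x * \<phi> l y))"
    have "(\<Sum>x\<in>C. \<Sum>y\<in>C. \<Sum>i<?r. \<Sum>j<?r. ?f x y i j) = (\<Sum>x\<in>C. \<Sum>i<?r. \<Sum>j<?r. \<Sum>y\<in>C. ?f x y i j)"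
      by (intro sum.cong refl) (subst sum.swap, intro sum.cong refl, rule sum.swap)
    also have "\<dots> = (\<Sum>i<?r. \<Sum>j<?r. \<Sum>x\<in>C. \<Sum>y\<in>C. ?f x y i j)"
      by (subst sum.swap, intro sum.cong refl, rule sum.swap)
    finally show "(\<Sum>x\<in>C. \<Sum>y\<in>C. \<Sum>i<?r. \<Sum>j<?r. ?f x y i j) =
        (\<Sum>i<?r. \<Sum>j<?r. M $$ (i, j) * (v l i * v l j))"
      by (simp only: vv sum_distrib_left)
  qed
  also have "\<dots> \<ge> 0" by (intro sum_nonneg psd_quadratic_form[OF M])
  finally show ?thesis .
qed

lemma mat_inner_S_mat:
  assumes "M \<in> carrier_mat (d - k + 1) (d - k + 1)"
  shows "mat_inner M (S_mat n d k x y z) = (1 / 6) *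
    (mat_inner M (Y_mat n d k x y z) + mat_inner M (Y_mat n d k x z y) +
     mat_inner M (Y_mat n d k y x z) + mat_inner M (Y_mat n d k y z x) +
     mat_inner M (Y_mat n d k z x y) + mat_inner M (Y_mat n d k z y x))"
proof -
  let ?r = "d - k + 1"
  have S: "S_mat n d k x y z \<in> carrier_mat ?r ?r"
    unfolding S_mat_def by (intro smult_carrier_mat add_carrier_mat Y_mat_carrier)
  have entry: "S_mat n d k x y z $$ (i, j) = (1 / 6) *
    (Y_mat n d k x y z $$ (i, j) + Y_mat n d k x z y $$ (i, j) + Y_mat n d k y x z $$ (i, j) +
     Y_mat n d k y z x $$ (i, j) + Y_mat n d k z x y $$ (i, j) + Y_mat n d k z y x $$ (i, j))"
    if "i < ?r" "j < ?r" for i j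
    using that by (simp add: S_mat_def Y_mat_def)
  have "mat_inner M (S_mat n d k x y z) = (\<Sum>i<?r. \<Sum>j<?r. (1 / 6) *
      (M $$ (i, j) * Y_mat n d k x y z $$ (i, j) + M $$ (i, j) * Y_mat n d k x z y $$ (i, j) +
       M $$ (i, j) * Y_mat n d k y x z $$ (i, j) + M $$ (i, j) * Y_mat n d k y z x $$ (i, j) +
       M $$ (i, j) * Y_mat n d k z x y $$ (i, j) + M $$ (i, j) * Y_mat n d k z y x $$ (i, j)))"
    unfolding mat_inner_expand[OF assms S]
    by (intro sum.cong refl) (simp add: entry distrib_left)
  also have "\<dots> = (1 / 6) *
    (mat_inner M (Y_mat n d k x y z) + mat_inner M (Y_mat n d k x z y) +
     mat_inner M (Y_mat n d k y x z) + mat_inner M (Y_mat n d k y z x) +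
     mat_inner M (Y_mat n d k z x y) + mat_inner M (Y_mat n d k z y x))"
    unfolding mat_inner_expand[OF assms Y_mat_carrier]
    by (simp only: sum_distrib_left[symmetric] sum.distrib)
  finally show ?thesis .
qed

lemma sum_mat_inner_S_mat_nonneg:
  fixes C :: "(real ^ 'n) set"
  assumes n: "CARD('n) \<ge> 3" and C: "C \<subseteq> sphere 0 1" and M: "psd (d - k + 1) M"
  shows "0 \<le> (\<Sum>x\<in>C. \<Sum>y\<in>C. \<Sum>z\<in>C.
    mat_inner M (S_mat CARD('n) d k (x \<bullet> y) (x \<bullet> z) (y \<bullet> z)))"
proof -
  define f where "f x y z = mat_inner M (Y_mat CARD('n) d k (x \<bullet> y) (x \<bullet> z) (y \<bullet> z))"
    for x y z :: "real ^ 'n"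
  define total where "total h = (\<Sum>x\<in>C. \<Sum>y\<in>C. \<Sum>z\<in>C. h x y z)"
    for h :: "real ^ 'n \<Rightarrow> real ^ 'n \<Rightarrow> real ^ 'n \<Rightarrow> real"
  have swap12: "total (\<lambda>x y z. h y x z) = total h" for h
    unfolding total_def by (rule sum.swap)
  have swap23: "total (\<lambda>x y z. h x z y) = total h" for h
    unfolding total_def by (rule sum.cong[OF refl], rule sum.swap)
  have perms: "total (\<lambda>x y z. f y x z) = total f" "total (\<lambda>x y z. f x z y) = total f"
    "total (\<lambda>x y z. f z x y) = total f" "total (\<lambda>x y z. f y z x) = total f"
    "total (\<lambda>x y z. f z y x) = total f"
    using swap12[of f] swap23[of f] swap12[of "\<lambda>x y z. f x z y"] swap23[of "\<lambda>x y z. f y x z"]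
      swap12[of "\<lambda>x y z. f z x y"] by (simp_all only:)
  have "total (\<lambda>x y z. mat_inner M (S_mat CARD('n) d k (x \<bullet> y) (x \<bullet> z) (y \<bullet> z))) =
      total (\<lambda>x y z. (1 / 6) * (f x y z + f y x z + f x z y + f z x y + f y z x + f z y x))"
    by (simp add: mat_inner_S_mat[OF psd_carrier[OF M]] f_def inner_commute add_ac)
  also have "\<dots> = (1 / 6) * (total f + total (\<lambda>x y z. f y x z) + total (\<lambda>x y z. f x z y) +
      total (\<lambda>x y z. f z x y) + total (\<lambda>x y z. f y z x) + total (\<lambda>x y z. f z y x))"
    unfolding total_def by (simp only: sum_distrib_left[symmetric] sum.distrib)
  also have "\<dots> = total f" unfolding perms by simp
  also have "\<dots> \<ge> 0"
    unfolding total_def f_def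
    by (rule sum_nonneg, rule sum_mat_inner_Y_mat_nonneg[OF n _ C M], rule subsetD[OF C])
  finally show ?thesis by (simp add: total_def)
qed

lemma mat_inner_E0_S_mat:
  assumes n: "n \<ge> 3"
  shows "mat_inner (E0_mat (d + 1)) (S_mat n d 0 x y z) = 1"
proof -
  let ?P = "gegenbauer (n - 1) 0"
  have P: "degree ?P = 0" "poly ?P 1 = 1"
    using gegenbauer_family_gegenbauer[of "n - 1"] n by (auto simp: gegenbauer_family_def)
  then have c: "coeff ?P 0 = 1" by (simp add: poly_altdef)
  have "mat_inner (E0_mat (d + 1)) (Y_mat n d 0 x y z) = 1" for x y z
  proof -
    have "(\<Sum>i<d+1. \<Sum>j<d+1. E0_mat (d + 1) $$ (i, j) * (x ^ i * y ^ j)) =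
        (\<Sum>i<d+1. \<Sum>j<d+1. if j = 0 then if i = 0 then 1 else 0 else 0)"
      by (intro sum.cong refl) (auto simp: E0_mat_def)
    also have "\<dots> = 1" by (simp only: sum.delta finite_lessThan) simp
    finally show ?thesis
      using c by (subst mat_inner_Y_mat) (simp_all add: Y_factor_def E0_mat_def)
  qed
  then show ?thesis by (subst mat_inner_S_mat) (simp_all add: E0_mat_def)
qed

lemma BV_sum_lower_bound:
  fixes C :: "(real ^ 'n) set"
  assumes n: "CARD('n) \<ge> 3" and C: "finite C" "C \<subseteq> sphere 0 1" and F: "F \<in> BV CARD('n) f0"
  shows "f0 * real (card C) ^ 3 \<le> (\<Sum>x\<in>C. \<Sum>y\<in>C. \<Sum>z\<in>C. F (x \<bullet> y) (x \<bullet> z) (y \<bullet> z))"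
proof -
  obtain d M where M: "\<And>k. k \<le> d \<Longrightarrow> psd (d - k + 1) (M k)"
    and M0: "psd (d + 1) (M 0 - f0 \<cdot>\<^sub>m E0_mat (d + 1))"
    and F: "\<And>x y z. F x y z = (\<Sum>k\<le>d. mat_inner (M k) (S_mat CARD('n) d k x y z))"
    using F by (auto simp: BV_def)
  define M' where "M' k = (if k = 0 then M 0 - f0 \<cdot>\<^sub>m E0_mat (d + 1) else M k)" for k
  have M': "psd (d - k + 1) (M' k)" if "k \<le> d" for k
    using M M0 that by (simp add: M'_def)
  have E0: "E0_mat (d + 1) \<in> carrier_mat (d + 1) (d + 1)" by (simp add: E0_mat_def)
  have split0: "mat_inner (M 0) (S_mat CARD('n) d 0 x y z) =
      mat_inner (M' 0) (S_mat CARD('n) d 0 x y z) + f0" for x y z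
  proof -
    have S: "S_mat CARD('n) d 0 x y z \<in> carrier_mat (d + 1) (d + 1)"
      using Y_mat_carrier[of _ d 0] by (simp add: S_mat_def)
    have "mat_inner (M 0) (S_mat CARD('n) d 0 x y z) = mat_inner (M' 0) (S_mat CARD('n) d 0 x y z) +
        f0 * mat_inner (E0_mat (d + 1)) (S_mat CARD('n) d 0 x y z)"
    proof -
      have c: "M 0 \<in> carrier_mat (d + 1) (d + 1)" "M' 0 \<in> carrier_mat (d + 1) (d + 1)"
        using M[of 0] M'[of 0] by (auto simp: psd_def)
      have "M 0 $$ (i, j) = M' 0 $$ (i, j) + f0 * E0_mat (d + 1) $$ (i, j)"
        if "i < d + 1" "j < d + 1" for i j
        using that E0 c by (simp add: M'_def)
      then show ?thesis
        unfolding mat_inner_expand[OF c(1) S] mat_inner_expand[OF c(2) S] mat_inner_expand[OF E0 S]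
        by (simp add: sum_distrib_left sum.distrib[symmetric] algebra_simps del: sum.lessThan_Suc)
    qed
    then show ?thesis using mat_inner_E0_S_mat[OF n] by simp
  qed
  have F': "F x y z = f0 + (\<Sum>k\<le>d. mat_inner (M' k) (S_mat CARD('n) d k x y z))" for x y z
  proof -
    have "F x y z = (\<Sum>k\<le>d. mat_inner (M' k) (S_mat CARD('n) d k x y z) + (if k = 0 then f0 else 0))"
      unfolding F by (intro sum.cong refl) (simp add: split0, simp add: M'_def)
    then show ?thesis by (simp add: sum.distrib)
  qed
  have "(\<Sum>x\<in>C. \<Sum>y\<in>C. \<Sum>z\<in>C. F (x \<bullet> y) (x \<bullet> z) (y \<bullet> z)) = f0 * real (card C) ^ 3 +
      (\<Sum>x\<in>C. \<Sum>y\<in>C. \<Sum>z\<in>C. \<Sum>k\<le>d. mat_inner (M' k) (S_mat CARD('n) d k (x \<bullet> y) (x \<bullet> z) (y \<bullet> z)))"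
    unfolding F' by (simp add: sum.distrib power3_eq_cube mult_ac)
  moreover have "(\<Sum>x\<in>C. \<Sum>y\<in>C. \<Sum>z\<in>C. \<Sum>k\<le>d.
        mat_inner (M' k) (S_mat CARD('n) d k (x \<bullet> y) (x \<bullet> z) (y \<bullet> z))) =
      (\<Sum>k\<le>d. \<Sum>x\<in>C. \<Sum>y\<in>C. \<Sum>z\<in>C.
        mat_inner (M' k) (S_mat CARD('n) d k (x \<bullet> y) (x \<bullet> z) (y \<bullet> z)))"
    by (subst (3) sum.swap, subst (2) sum.swap, subst sum.swap) (rule refl)
  moreover have "0 \<le> (\<Sum>k\<le>d. \<Sum>x\<in>C. \<Sum>y\<in>C. \<Sum>z\<in>C.
        mat_inner (M' k) (S_mat CARD('n) d k (x \<bullet> y) (x \<bullet> z) (y \<bullet> z)))"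
    by (rule sum_nonneg, rule sum_mat_inner_S_mat_nonneg[OF n C(2) M']) simp
  ultimately show ?thesis by simp
qed


section \<open>The upper bound and distance graphs\<close>

lemma sum_ext_zero_eq_H_sum:
  fixes C :: "(real ^ 'n) set"
  assumes fin: "finite C" and C: "C \<subseteq> sphere 0 1" and T: "1 \<notin> T"
  shows "(\<Sum>x\<in>C. \<Sum>y\<in>C. ext_zero T g (x \<bullet> y)) = 2 * H_sum g C T"
proof -
  define P where "P = {(x, y). x \<in> C \<and> y \<in> C \<and> x \<bullet> y \<in> T}"
  have finP: "finite P" by (rule finite_subset[of _ "C \<times> C"]) (auto simp: P_def fin)
  let ?h = "\<lambda>(x, y). {x, y}"
  have ne: "x \<noteq> y" if "(x, y) \<in> P" for x y
    using that C T by (auto simp: P_def dot_square_norm)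
  have edges: "?h ` P = DG_edges C T"
    using ne unfolding DG_edges_def P_def by (fastforce simp: image_iff)
  have "(\<Sum>x\<in>C. \<Sum>y\<in>C. ext_zero T g (x \<bullet> y)) = (\<Sum>p\<in>C \<times> C. ext_zero T g (fst p \<bullet> snd p))"
    by (simp add: sum.cartesian_product case_prod_beta)
  also have "\<dots> = (\<Sum>p\<in>P. g (fst p \<bullet> snd p))"
    by (rule sum.mono_neutral_cong_right) (auto simp: fin P_def ext_zero_def)
  also have "\<dots> = (\<Sum>a\<in>DG_edges C T. \<Sum>p\<in>{p \<in> P. ?h p = a}. g (fst p \<bullet> snd p))"
    unfolding edges[symmetric] by (rule sum.image_gen[OF finP])
  also have "\<dots> = (\<Sum>a\<in>DG_edges C T. 2 * g (edge_inner a))"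
  proof (rule sum.cong[OF refl])
    fix a assume "a \<in> DG_edges C T"
    then have "a \<in> ?h ` P" by (simp only: edges)
    then obtain x y where xy: "(x, y) \<in> P" "a = {x, y}" by auto
    have "(y, x) \<in> P" using xy(1) inner_commute[of y x] by (simp add: P_def)
    have "{p \<in> P. ?h p = a} = {(x, y), (y, x)}"
    proof (intro equalityI subsetI)
      fix p assume "p \<in> {p \<in> P. ?h p = a}"
      then have "{fst p, snd p} = {x, y}" by (simp add: xy(2) case_prod_beta)
      then show "p \<in> {(x, y), (y, x)}" by (cases p) (auto simp: doubleton_eq_iff)
    next
      fix p assume "p \<in> {(x, y), (y, x)}"
      then show "p \<in> {p \<in> P. ?h p = a}"
        using xy \<open>(y, x) \<in> P\<close> by (elim insertE emptyE) (simp_all add: insert_commute)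
    qed
    then show "(\<Sum>p\<in>{p \<in> P. ?h p = a}. g (fst p \<bullet> snd p)) = 2 * g (edge_inner a)"
      using ne[OF xy(1)] by (simp add: xy(2) edge_inner_pair inner_commute)
  qed
  finally show ?thesis by (simp add: H_sum_def sum_distrib_left)
qed

lemma graph_degree_DG:
  fixes c :: "real ^ 'n"
  assumes c: "c \<in> C" and T: "c \<bullet> c \<notin> T"
  shows "graph_degree (DG C T) c = card {c' \<in> C. c \<bullet> c' \<in> T}"
proof -
  have "{a \<in> DG_edges C T. c \<in> a} = (\<lambda>c'. {c, c'}) ` {c' \<in> C. c \<bullet> c' \<in> T}"
    using c T by (auto simp: DG_edges_def inner_commute image_iff insert_commute)
  moreover have "inj_on (\<lambda>c'. {c, c'}) {c' \<in> C. c \<bullet> c' \<in> T}"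
    by (auto simp: inj_on_def doubleton_eq_iff)
  ultimately show ?thesis by (simp add: graph_degree_def DG_def card_image)
qed

lemma isometry_between_vectors:
  fixes a b :: "'a::real_inner"
  assumes "norm a = norm b"
  shows "\<exists>f :: 'a \<Rightarrow> 'a. f a = b \<and> (\<forall>x y. inner (f x) (f y) = inner x y)"
proof -
  define u where "u = a - b"
  let ?f = "\<lambda>x. x - (2 * inner u x / inner u u) *\<^sub>R u"
  have "inner a a = inner b b" using assms by (simp add: dot_square_norm)
  then have uu: "inner u u = 2 * inner u a"
    by (simp add: u_def inner_diff_left inner_diff_right inner_commute)
  have "?f a = b"
  proof (cases "u = 0")
    case False
    then have "2 * inner u a / inner u u = 1" by (simp add: uu[symmetric])
    then have "?f a = a - u" by (simp only: scaleR_one)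
    then show ?thesis by (simp add: u_def)
  qed (simp add: u_def)
  moreover have "inner (?f x) (?f y) = inner x y" for x y
    by (cases "u = 0")
      (simp_all add: inner_diff_left inner_diff_right inner_commute[of x u] field_simps)
  ultimately show ?thesis by (intro exI[of _ ?f]) blast
qed

lemma sum_ext_zero_le_h_val:
  fixes C :: "(real ^ 'n) set" and e :: "real ^ 'n"
  assumes code: "spherical_code N \<theta> C" and e: "e \<in> sphere 0 1" and T: "1 \<notin> T" and c: "c \<in> C"
  shows "ereal (\<Sum>c'\<in>C. ext_zero T g (c \<bullet> c')) \<le> h_val e (graph_degree (DG C T) c) \<theta> T g"
proof -
  define A where "A = {c' \<in> C. c \<bullet> c' \<in> T}"
  have C: "finite C" "C \<subseteq> sphere 0 1"
    "\<And>x y. x \<in> C \<Longrightarrow> y \<in> C \<Longrightarrow> x \<noteq> y \<Longrightarrow> x \<bullet> y \<le> cos \<theta>"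
    using code by (auto simp: spherical_code_def)
  have cc: "c \<bullet> c = 1" using C(2) c by (auto simp: dot_square_norm)
  have deg: "graph_degree (DG C T) c = card A"
    unfolding A_def using c T cc by (intro graph_degree_DG) auto
  have sum: "(\<Sum>c'\<in>C. ext_zero T g (c \<bullet> c')) = (\<Sum>c'\<in>A. g (c \<bullet> c'))"
    by (rule sum.mono_neutral_cong_right) (auto simp: C A_def ext_zero_def)
  have finA: "finite A" using C(1) by (simp add: A_def)
  show ?thesis
  proof (cases "A = {}")
    case True
    then show ?thesis unfolding sum deg by (simp add: h_val_def)
  next
    case False
    then have pos: "card A \<noteq> 0" using finA by simp
    have "norm c = norm e" using C(2) c e by auto
    then obtain f where f: "f c = e" and ff: "\<And>x y. inner (f x) (f y) = inner x y"
      using isometry_between_vectors by blast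
    have "inj f"
    proof (rule injI)
      fix x y assume "f x = f y"
      moreover have "(f x - f y) \<bullet> (f x - f y) = (x - y) \<bullet> (x - y)"
        by (simp add: inner_diff_left inner_diff_right ff)
      ultimately show "x = y" by simp
    qed
    then have injA: "inj_on f A" by (rule inj_on_subset) simp
    have "f ` A \<in> Q_pole e (card A) \<theta> T"
      unfolding Q_pole_def spherical_code_def
    proof (intro CollectI conjI ballI impI)
      show "1 \<le> card A" using pos by simp
      show "finite (f ` A)" using finA by simp
      show "card (f ` A) = card A" using injA by (rule card_image)
      show "f ` A \<subseteq> sphere 0 1"
        using C(2) by (auto simp: A_def norm_eq_sqrt_inner ff)
      show "u \<bullet> v \<le> cos \<theta>" if uv: "u \<in> f ` A" "v \<in> f ` A" "u \<noteq> v" for u v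
      proof -
        obtain x y where "x \<in> C" "y \<in> C" "u = f x" "v = f y"
          using uv by (auto simp: A_def)
        then show ?thesis using C(3)[of x y] \<open>u \<noteq> v\<close> by (auto simp: ff)
      qed
      show "u \<bullet> e \<in> T" if "u \<in> f ` A" for u
        using that unfolding f[symmetric] by (auto simp: ff A_def inner_commute)
    qed
    then have "ereal (\<Sum>y\<in>f ` A. g (e \<bullet> y)) \<le> h_val e (card A) \<theta> T g"
      using pos unfolding h_val_def by (auto intro!: SUP_upper)
    moreover have "(\<Sum>y\<in>f ` A. g (e \<bullet> y)) = (\<Sum>c'\<in>A. g (c \<bullet> c'))"
      unfolding f[symmetric] by (simp add: sum.reindex[OF injA] ff)
    ultimately show ?thesis unfolding sum deg by simp
  qed
qed

lemma gram_det_nonneg: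
  fixes x y z :: "'a::real_inner"
  assumes "norm x = 1" "norm y = 1" "norm z = 1"
  shows "1 + 2 * (x \<bullet> y) * (x \<bullet> z) * (y \<bullet> z) - (x \<bullet> y)\<^sup>2 - (x \<bullet> z)\<^sup>2 - (y \<bullet> z)\<^sup>2 \<ge> 0"
proof -
  let ?u = "y - (x \<bullet> y) *\<^sub>R x" and ?v = "z - (x \<bullet> z) *\<^sub>R x"
  have 1: "x \<bullet> x = 1" "y \<bullet> y = 1" "z \<bullet> z = 1" using assms by (simp_all add: dot_square_norm)
  have "?u \<bullet> ?v = y \<bullet> z - (x \<bullet> y) * (x \<bullet> z)" "?u \<bullet> ?u = 1 - (x \<bullet> y)\<^sup>2" "?v \<bullet> ?v = 1 - (x \<bullet> z)\<^sup>2"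
    by (simp_all add: inner_diff_left inner_diff_right 1 power2_eq_square) (simp_all add: inner_commute)
  then have "(y \<bullet> z - (x \<bullet> y) * (x \<bullet> z))\<^sup>2 \<le> (1 - (x \<bullet> y)\<^sup>2) * (1 - (x \<bullet> z)\<^sup>2)"
    using Cauchy_Schwarz_ineq[of ?u ?v] by simp
  then show ?thesis by (simp add: algebra_simps power2_eq_square)
qed

text \<open>
  The last two summands account for triples with coinciding entries, where condition (2) applies
  and \<open>g\<^sub>T(1) = 0\<close>.
\<close>

lemma class_F_triple_le:
  fixes x y z :: "real ^ 'n"
  assumes F: "F \<in> class_F CARD('n) f0 T g B \<theta>" and T: "1 \<notin> T"
    and code: "spherical_code N \<theta> C" and xyz: "x \<in> C" "y \<in> C" "z \<in> C"
  shows "F (x \<bullet> y) (x \<bullet> z) (y \<bullet> z) \<le>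
    ext_zero T g (x \<bullet> y) + ext_zero T g (x \<bullet> z) + ext_zero T g (y \<bullet> z) +
    B * (of_bool (x = y) + of_bool (x = z) + of_bool (y = z)) +
    (F 1 1 1 - 3 * B) * (of_bool (x = y) * of_bool (x = z))"
proof -
  have sym: "F a b c = F b a c" "F a b c = F a c b" for a b c
    using F by (auto simp: class_F_def symmetric_poly3_def)
  have F2: "F a a 1 \<le> B + 2 * ext_zero T g a" if "a \<in> {-1..cos \<theta>}" for a
    using F that by (auto simp: class_F_def)
  have F3: "F a b c \<le> ext_zero T g a + ext_zero T g b + ext_zero T g c" if "(a, b, c) \<in> D_region \<theta>" for a b c
    using F that by (auto simp: class_F_def)
  have norm: "norm u = 1" if "u \<in> C" for u
    using code that by (auto simp: spherical_code_def)
  have unit: "u \<bullet> u = 1" if "u \<in> C" for u using norm[OF that] by (simp add: dot_square_norm)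
  have range: "u \<bullet> v \<in> {-1..cos \<theta>}" if "u \<in> C" "v \<in> C" "u \<noteq> v" for u v
    using code that Cauchy_Schwarz_ineq2[of u v] norm[OF that(1)] norm[OF that(2)]
    by (auto simp: spherical_code_def)
  have G1: "ext_zero T g 1 = 0" using T by (simp add: ext_zero_def)
  consider "x = y" "y = z" | "x = y" "y \<noteq> z" | "x = z" "x \<noteq> y" | "y = z" "x \<noteq> y"
    | "x \<noteq> y" "x \<noteq> z" "y \<noteq> z" by blast
  then show ?thesis
  proof cases
    case 1
    then show ?thesis using xyz by (simp add: unit G1)
  next
    case 2
    have "F 1 (x \<bullet> z) (x \<bullet> z) = F (x \<bullet> z) (x \<bullet> z) 1" using sym by metis
    then show ?thesis using 2 F2[OF range[OF xyz(1,3)]] xyz by (simp add: unit G1)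
  next
    case 3
    have "F (x \<bullet> y) 1 (x \<bullet> y) = F (x \<bullet> y) (x \<bullet> y) 1" using sym by metis
    then show ?thesis using 3 F2[OF range[OF xyz(1,2)]] xyz by (simp add: unit G1 inner_commute)
  next
    case 4
    then show ?thesis using F2[OF range[OF xyz(1,2)]] xyz by (simp add: unit G1)
  next
    case 5
    have "(x \<bullet> y, x \<bullet> z, y \<bullet> z) \<in> D_region \<theta>"
      using range[OF xyz(1,2)] range[OF xyz(1,3)] range[OF xyz(2,3)] 5
        gram_det_nonneg[OF norm[OF xyz(1)] norm[OF xyz(2)] norm[OF xyz(3)]]
      by (simp add: D_region_def)
    from F3[OF this] show ?thesis using 5 by simp
  qed
qed

lemma class_F_sum_upper_bound:
  fixes C :: "(real ^ 'n) set"
  assumes F: "F \<in> class_F CARD('n) f0 T g B \<theta>" and T: "1 \<notin> T" and code: "spherical_code N \<theta> C"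
  shows "(\<Sum>x\<in>C. \<Sum>y\<in>C. \<Sum>z\<in>C. F (x \<bullet> y) (x \<bullet> z) (y \<bullet> z)) \<le>
    real N * (F 1 1 1 + 3 * (real N - 1) * B + 6 * H_sum g C T)"
proof -
  have C: "finite C" "card C = N" "C \<subseteq> sphere 0 1" using code by (auto simp: spherical_code_def)
  let ?G = "\<lambda>x y :: real ^ 'n. ext_zero T g (x \<bullet> y)" and ?d = "\<lambda>x y :: real ^ 'n. of_bool (x = y) :: real"
  have d: "(\<Sum>y\<in>C. ?d x y) = 1" if "x \<in> C" for x
    using C(1) that by (simp add: of_bool_def)
  have "(\<Sum>x\<in>C. \<Sum>y\<in>C. \<Sum>z\<in>C. F (x \<bullet> y) (x \<bullet> z) (y \<bullet> z)) \<le>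
      (\<Sum>x\<in>C. \<Sum>y\<in>C. \<Sum>z\<in>C. ?G x y + ?G x z + ?G y z +
        B * (?d x y + ?d x z + ?d y z) + (F 1 1 1 - 3 * B) * (?d x y * ?d x z))"
    by (intro sum_mono class_F_triple_le[OF F T code])
  also have "\<dots> = (\<Sum>x\<in>C. \<Sum>y\<in>C. \<Sum>z\<in>C. ?G x y) + (\<Sum>x\<in>C. \<Sum>y\<in>C. \<Sum>z\<in>C. ?G x z) +
      (\<Sum>x\<in>C. \<Sum>y\<in>C. \<Sum>z\<in>C. ?G y z) +
      B * ((\<Sum>x\<in>C. \<Sum>y\<in>C. \<Sum>z\<in>C. ?d x y) + (\<Sum>x\<in>C. \<Sum>y\<in>C. \<Sum>z\<in>C. ?d x z) +
        (\<Sum>x\<in>C. \<Sum>y\<in>C. \<Sum>z\<in>C. ?d y z)) +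
      (F 1 1 1 - 3 * B) * (\<Sum>x\<in>C. \<Sum>y\<in>C. \<Sum>z\<in>C. ?d x y * ?d x z)"
    by (simp only: sum.distrib sum_distrib_left[symmetric])
  also have "(\<Sum>x\<in>C. \<Sum>y\<in>C. \<Sum>z\<in>C. ?G x y) = real N * (2 * H_sum g C T)"
    by (simp add: sum_ext_zero_eq_H_sum[OF C(1,3) T, symmetric] C(2) sum_distrib_left)
  also have "(\<Sum>x\<in>C. \<Sum>y\<in>C. \<Sum>z\<in>C. ?G x z) = real N * (2 * H_sum g C T)"
    by (simp add: sum_ext_zero_eq_H_sum[OF C(1,3) T, symmetric] C(2) sum_distrib_left)
  also have "(\<Sum>x\<in>C. \<Sum>y\<in>C. \<Sum>z\<in>C. ?G y z) = real N * (2 * H_sum g C T)"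
    by (simp add: sum_ext_zero_eq_H_sum[OF C(1,3) T, symmetric] C(2) sum_distrib_left)
  also have "(\<Sum>x\<in>C. \<Sum>y\<in>C. \<Sum>z\<in>C. ?d x y) = real N * real N"
    using d by (simp add: C(2) sum_distrib_left[symmetric])
  also have "(\<Sum>x\<in>C. \<Sum>y\<in>C. \<Sum>z\<in>C. ?d x z) = real N * real N"
    using d by (simp add: C(2))
  also have "(\<Sum>x\<in>C. \<Sum>y\<in>C. \<Sum>z\<in>C. ?d y z) = real N * real N"
    using d by (simp add: C(2))
  also have "(\<Sum>x\<in>C. \<Sum>y\<in>C. \<Sum>z\<in>C. ?d x y * ?d x z) = real N"
    using d by (simp add: C(2) sum_product[symmetric])
  finally show ?thesis by (simp add: algebra_simps)
qed

theorem theorem2: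
  fixes F :: "real \<Rightarrow> real \<Rightarrow> real \<Rightarrow> real"
    and G :: "'v graph"
    and C :: "(real ^ 'n) set"
    and e :: "real ^ 'n"
    and T :: "real set"
    and g :: "real \<Rightarrow> real"
    and f0 B \<theta> :: real
    and N :: nat
  assumes "CARD('n) \<ge> 3"
    and "0 < \<theta>" and "\<theta> \<le> pi"
    and "0 < f0"
    and "T \<subseteq> {-1..<1}"
    and "e \<in> sphere 0 1"
    and "F \<in> class_F CARD('n) f0 T g B \<theta>"
    and "simple_graph G" and "card (fst G) = N"
    and "spherical_code N \<theta> C"
    and "graph_iso (DG C T) G"
  shows "ereal ((real N)\<^sup>2) \<le>
    (ereal (F 1 1 1 + 3 * (real N - 1) * B) + 6 * tau e G \<theta> T g) / ereal f0"
proof -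
  let ?A = "F 1 1 1 + 3 * (real N - 1) * B" and ?H = "H_sum g C T"
  have T: "1 \<notin> T" using assms(5) by auto
  have C: "finite C" "card C = N" "C \<subseteq> sphere 0 1" "N \<ge> 1"
    using assms(10) by (auto simp: spherical_code_def)
  have "F \<in> BV CARD('n) f0" using assms(7) by (simp add: class_F_def)
  then have "f0 * real N ^ 3 \<le> real N * (?A + 6 * ?H)"
    using BV_sum_lower_bound[OF assms(1) C(1,3)] class_F_sum_upper_bound[OF assms(7) T assms(10)]
    unfolding C(2) by fastforce
  then have "real N * (f0 * (real N)\<^sup>2) \<le> real N * (?A + 6 * ?H)"
    by (simp add: power2_eq_square power3_eq_cube mult_ac)
  then have "f0 * (real N)\<^sup>2 \<le> ?A + 6 * ?H" using C(4) by simp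
  then have "(real N)\<^sup>2 \<le> (?A + 6 * ?H) / f0"
    using assms(4) by (simp add: pos_le_divide_eq mult.commute)
  then have "ereal ((real N)\<^sup>2) \<le> (ereal ?A + 6 * ereal ?H) / ereal f0"
    using assms(4) by (simp add: numeral_eq_ereal)
  also have "\<dots> \<le> (ereal ?A + 6 * tau e G \<theta> T g) / ereal f0"
  proof -
    have "C \<in> Q_graph G \<theta> T" using assms(9-11) by (simp add: Q_graph_def)
    then have "ereal ?H \<le> tau e G \<theta> T g"
      using sum_ext_zero_le_h_val[OF assms(10,6) T] unfolding tau_def by (auto intro!: SUP_upper)
    then have "ereal ?A + 6 * ereal ?H \<le> ereal ?A + 6 * tau e G \<theta> T g"
      by (intro add_left_mono ereal_mult_left_mono) simp_all
    then show ?thesis using assms(4) by (intro ereal_divide_right_mono) auto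
  qed
  finally show ?thesis .
qed

end
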